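(* Let $\mathbf{P}$ be a prevariety, and let $\preceq$ be the preordering "is embeddable in" among algebras in $\mathbf{P}$. Then the following conditions are equivalent: (1) Every set of nontrivial algebras in $\mathbf{P}$ is $\mathbf{P}$-compatible. (2) $\mathbf{P}$ is generated as a prevariety by a class of algebras absolutely directed under $\preceq$. Moreover, if $\mathbf{P}$ is a quasivariety, then conditions (1) and (2) are also equivalent to each of: (3) Every pair of nontrivial algebras in $\mathbf{P}$ is $\mathbf{P}$-compatible. (4) $\mathbf{P}$ is generated as a quasivariety by a class of algebras absolutely directed under $\preceq$. (5) $\mathbf{P}$ is generated as a quasivariety by a single algebra.
   Context: Algebras may have operations of infinite arity unless stated to be finitary; the empty algebra is admitted when there are no zeroary operations. The trivial algebra means the one-element algebra (so the empty algebra counts as nontrivial). For a class $\mathbf{X}$ of algebras of the same type, $\mathbb{S}\,\mathbf{X}$ is the class of algebras isomorphic to subalgebras of members of $\mathbf{X}$, and $\mathbb{P}\,\mathbf{X}$ the class of algebras isomorphic to direct products of (possibly empty) families of members of $\mathbf{X}$. A prevariety is a class of algebras of a given type closed under $\mathbb{S}$ and $\mathbb{P}$; the prevariety generated by $\mathbf{X}$ is $\mathbb{S}\,\mathbb{P}\,\mathbf{X}$. A quasivariety is a prevariety of finitary algebras (all primitive operations of finite arity) that is closed under ultraproducts; equivalently, that is definable by conditions $(\forall x\in A^I)\ (\bigwedge_{j\in J}a_j(x)=b_j(x))\Rightarrow c(x)=d(x)$ with $I,J$ finite and $a_j,b_j,c,d$ terms. The quasivariety generated by $\mathbf{X}$ is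 the least quasivariety containing $\mathbf{X}$, namely $\mathbb{S}\,\mathbb{P}\,\mathbb{P}_{\mathrm{ult}}\,\mathbf{X}$, where $\mathbb{P}_{\mathrm{ult}}$ denotes forming ultraproducts (and algebras isomorphic thereto). A set $\mathbf{X}$ of algebras in $\mathbf{P}$ is called $\mathbf{P}$-compatible if for every $A_0\in\mathbf{X}$ the coprojection map from $A_0$ to the coproduct in $\mathbf{P}$ of all $A\in\mathbf{X}$ is one-to-one; equivalently, if there exists an algebra $B$ in $\mathbf{P}$ admitting one-to-one homomorphisms $A\to B$ for all $A\in\mathbf{X}$. A preordered class $(\mathbf{K},\preceq)$ is absolutely directed if every set of elements of $\mathbf{K}$ is majorized by some element of $\mathbf{K}$ (a single element $\succeq$ all of them). *)

theory Defs
  imports "HOL-Library.FuncSet" "HOL-Library.Equipollence"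
begin

text \<open>
  Sets and classes are taken relative to a type \<open>'u\<close> of inaccessible cardinality, which plays the
  role of a universe: a ``set'' is a collection of cardinality smaller than that of \<open>'u\<close>, and a
  ``class'' of algebras is an arbitrary collection of algebras whose underlying sets are small
  subsets of \<open>'u\<close>. Every small set is in bijection with a small subset of \<open>'u\<close>, so every small
  algebra is isomorphic to one of these, and small subsets of \<open>'u\<close> suffice as index sets.
\<close>

definition small :: "'u itself \<Rightarrow> 'a set \<Rightarrow> bool" where
  "small _ A \<longleftrightarrow> A \<prec> (UNIV :: 'u set)"

text \<open>Uncountable, strong limit and regular.\<close>

definition inaccessible :: "'u itself \<Rightarrow> bool" where
  "inaccessible U \<longleftrightarrow>
     small U (UNIV :: nat set) \<and>
     (\<forall>A :: 'u set. small U A \<longrightarrow> small U (Pow A)) \<and>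
     (\<forall>(A :: 'u set) (B :: 'u \<Rightarrow> 'u set).
        small U A \<and> (\<forall>a\<in>A. small U (B a)) \<longrightarrow> small U (\<Union>a\<in>A. B a))"


subsection \<open>Algebras\<close>

text \<open>
  The arity of an operation symbol is a set, possibly infinite or empty; an operation of arity
  \<open>J\<close> on \<open>A\<close> takes as its argument a family \<open>x \<in> J \<rightarrow>\<^sub>E A\<close>.
\<close>

record ('f, 'i) signature =
  symbols :: "'f set"
  arity :: "'f \<Rightarrow> 'i set"

definition small_signature :: "'u itself \<Rightarrow> ('f, 'i) signature \<Rightarrow> bool" where
  "small_signature U \<Sigma> \<longleftrightarrow>
     small U (symbols \<Sigma>) \<and> (\<forall>f \<in> symbols \<Sigma>. small U (arity \<Sigma> f))"

definition finitary :: "('f, 'i) signature \<Rightarrow> bool" where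
  "finitary \<Sigma> \<longleftrightarrow> (\<forall>f \<in> symbols \<Sigma>. finite (arity \<Sigma> f))"

record ('f, 'i, 'a) algebra =
  carrier :: "'a set"
  oper :: "'f \<Rightarrow> ('i \<Rightarrow> 'a) \<Rightarrow> 'a"

text \<open>
  Operations are extensional, so that equality of records is equality of algebras. The empty carrier
  is allowed exactly when there is no symbol of empty arity.
\<close>

definition algebra :: "('f, 'i) signature \<Rightarrow> ('f, 'i, 'a) algebra \<Rightarrow> bool" where
  "algebra \<Sigma> A \<longleftrightarrow>
     oper A \<in> (\<Pi>\<^sub>E f \<in> symbols \<Sigma>. (arity \<Sigma> f \<rightarrow>\<^sub>E carrier A) \<rightarrow>\<^sub>E carrier A)"

definition algebras :: "('f, 'i) signature \<Rightarrow> ('f, 'i, 'u) algebra set" where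
  "algebras \<Sigma> = {A. algebra \<Sigma> A \<and> small TYPE('u) (carrier A)}"

definition trivial :: "('f, 'i, 'a) algebra \<Rightarrow> bool" where
  "trivial A \<longleftrightarrow> (\<exists>a. carrier A = {a})"

definition hom ::
    "('f, 'i) signature \<Rightarrow> ('f, 'i, 'a) algebra \<Rightarrow> ('f, 'i, 'b) algebra \<Rightarrow> ('a \<Rightarrow> 'b) set" where
  "hom \<Sigma> A B =
     {h \<in> carrier A \<rightarrow>\<^sub>E carrier B.
        \<forall>f \<in> symbols \<Sigma>. \<forall>x \<in> arity \<Sigma> f \<rightarrow>\<^sub>E carrier A.
          h (oper A f x) = oper B f (\<lambda>k \<in> arity \<Sigma> f. h (x k))}"

definition embeddable ::
    "('f, 'i) signature \<Rightarrow> ('f, 'i, 'a) algebra \<Rightarrow> ('f, 'i, 'b) algebra \<Rightarrow> bool" where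
  "embeddable \<Sigma> A B \<longleftrightarrow> (\<exists>h \<in> hom \<Sigma> A B. inj_on h (carrier A))"

definition isomorphic ::
    "('f, 'i) signature \<Rightarrow> ('f, 'i, 'a) algebra \<Rightarrow> ('f, 'i, 'b) algebra \<Rightarrow> bool" where
  "isomorphic \<Sigma> A B \<longleftrightarrow> (\<exists>h \<in> hom \<Sigma> A B. bij_betw h (carrier A) (carrier B))"

definition subalgebra ::
    "('f, 'i) signature \<Rightarrow> ('f, 'i, 'a) algebra \<Rightarrow> ('f, 'i, 'a) algebra \<Rightarrow> bool" where
  "subalgebra \<Sigma> B A \<longleftrightarrow>
     algebra \<Sigma> B \<and> carrier B \<subseteq> carrier A \<and>
     (\<forall>f \<in> symbols \<Sigma>. \<forall>x \<in> arity \<Sigma> f \<rightarrow>\<^sub>E carrier B. oper B f x = oper A f x)"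

definition product ::
    "('f, 'i) signature \<Rightarrow> 'j set \<Rightarrow> ('j \<Rightarrow> ('f, 'i, 'a) algebra) \<Rightarrow> ('f, 'i, 'j \<Rightarrow> 'a) algebra" where
  "product \<Sigma> I A =
     \<lparr>carrier = (\<Pi>\<^sub>E i \<in> I. carrier (A i)),
      oper = (\<lambda>f \<in> symbols \<Sigma>. \<lambda>x \<in> arity \<Sigma> f \<rightarrow>\<^sub>E (\<Pi>\<^sub>E i \<in> I. carrier (A i)).
        \<lambda>i \<in> I. oper (A i) f (\<lambda>k \<in> arity \<Sigma> f. x k i))\<rparr>"


subsection \<open>Ultraproducts\<close>

definition ultrafilter_on :: "'j set \<Rightarrow> 'j filter \<Rightarrow> bool" where
  "ultrafilter_on I F \<longleftrightarrow>
     F \<noteq> bot \<and> F \<le> principal I \<and>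
     (\<forall>Q. eventually Q F \<or> eventually (\<lambda>i. \<not> Q i) F)"

definition eventual_equality ::
    "'j set \<Rightarrow> 'j filter \<Rightarrow> ('j \<Rightarrow> ('f, 'i, 'a) algebra) \<Rightarrow> ('j \<Rightarrow> 'a) rel" where
  "eventual_equality I F A =
     {(x, y). x \<in> (\<Pi>\<^sub>E i \<in> I. carrier (A i)) \<and> y \<in> (\<Pi>\<^sub>E i \<in> I. carrier (A i)) \<and>
        (\<forall>\<^sub>F i in F. x i = y i)}"

text \<open>
  The operations are computed on chosen representatives; for operations of finite arity the result
  does not depend on the choice.
\<close>

definition ultraproduct ::
    "('f, 'i) signature \<Rightarrow> 'j set \<Rightarrow> 'j filter \<Rightarrow> ('j \<Rightarrow> ('f, 'i, 'a) algebra)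
      \<Rightarrow> ('f, 'i, ('j \<Rightarrow> 'a) set) algebra" where
  "ultraproduct \<Sigma> I F A =
     (let R = eventual_equality I F A; Q = carrier (product \<Sigma> I A) // R in
      \<lparr>carrier = Q,
       oper = (\<lambda>f \<in> symbols \<Sigma>. \<lambda>X \<in> arity \<Sigma> f \<rightarrow>\<^sub>E Q.
         R `` {oper (product \<Sigma> I A) f (\<lambda>k \<in> arity \<Sigma> f. SOME x. x \<in> X k)})\<rparr>)"


subsection \<open>Class operators, prevarieties and quasivarieties\<close>

definition Sub ::
    "('f, 'i) signature \<Rightarrow> ('f, 'i, 'u) algebra set \<Rightarrow> ('f, 'i, 'u) algebra set" where
  "Sub \<Sigma> X = {A \<in> algebras \<Sigma>. \<exists>B\<in>X. \<exists>C. subalgebra \<Sigma> C B \<and> isomorphic \<Sigma> A C}"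

definition Prod ::
    "('f, 'i) signature \<Rightarrow> ('f, 'i, 'u) algebra set \<Rightarrow> ('f, 'i, 'u) algebra set" where
  "Prod \<Sigma> X = {A \<in> algebras \<Sigma>. \<exists>(I :: 'u set) B.
     small TYPE('u) I \<and> (\<forall>i\<in>I. B i \<in> X) \<and> isomorphic \<Sigma> A (product \<Sigma> I B)}"

definition Ultraprod ::
    "('f, 'i) signature \<Rightarrow> ('f, 'i, 'u) algebra set \<Rightarrow> ('f, 'i, 'u) algebra set" where
  "Ultraprod \<Sigma> X = {A \<in> algebras \<Sigma>. \<exists>(I :: 'u set) F B.
     small TYPE('u) I \<and> ultrafilter_on I F \<and> (\<forall>i\<in>I. B i \<in> X) \<and>
     isomorphic \<Sigma> A (ultraproduct \<Sigma> I F B)}"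

definition prevariety :: "('f, 'i) signature \<Rightarrow> ('f, 'i, 'u) algebra set \<Rightarrow> bool" where
  "prevariety \<Sigma> P \<longleftrightarrow> P \<subseteq> algebras \<Sigma> \<and> Sub \<Sigma> P \<subseteq> P \<and> Prod \<Sigma> P \<subseteq> P"

definition quasivariety :: "('f, 'i) signature \<Rightarrow> ('f, 'i, 'u) algebra set \<Rightarrow> bool" where
  "quasivariety \<Sigma> Q \<longleftrightarrow> finitary \<Sigma> \<and> prevariety \<Sigma> Q \<and> Ultraprod \<Sigma> Q \<subseteq> Q"

definition prevariety_generated ::
    "('f, 'i) signature \<Rightarrow> ('f, 'i, 'u) algebra set \<Rightarrow> ('f, 'i, 'u) algebra set" where
  "prevariety_generated \<Sigma> X = Sub \<Sigma> (Prod \<Sigma> X)"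

definition quasivariety_generated ::
    "('f, 'i) signature \<Rightarrow> ('f, 'i, 'u) algebra set \<Rightarrow> ('f, 'i, 'u) algebra set" where
  "quasivariety_generated \<Sigma> X = \<Inter>{Q. quasivariety \<Sigma> Q \<and> X \<subseteq> Q}"


subsection \<open>Coproducts, compatibility and directedness\<close>

text \<open>
  A set \<open>X\<close> of algebras is regarded as a family indexed by itself; \<open>q A\<close> is the coprojection of \<open>A\<close>.
\<close>

definition coproduct ::
    "('f, 'i) signature \<Rightarrow> ('f, 'i, 'u) algebra set \<Rightarrow> ('f, 'i, 'u) algebra set
      \<Rightarrow> ('f, 'i, 'u) algebra \<Rightarrow> (('f, 'i, 'u) algebra \<Rightarrow> 'u \<Rightarrow> 'u) \<Rightarrow> bool" where
  "coproduct \<Sigma> P X C q \<longleftrightarrow>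
     C \<in> P \<and> (\<forall>A\<in>X. q A \<in> hom \<Sigma> A C) \<and>
     (\<forall>D\<in>P. \<forall>h. (\<forall>A\<in>X. h A \<in> hom \<Sigma> A D) \<longrightarrow>
        (\<exists>!g. g \<in> hom \<Sigma> C D \<and> (\<forall>A\<in>X. \<forall>a \<in> carrier A. g (q A a) = h A a)))"

definition compatible ::
    "('f, 'i) signature \<Rightarrow> ('f, 'i, 'u) algebra set \<Rightarrow> ('f, 'i, 'u) algebra set \<Rightarrow> bool" where
  "compatible \<Sigma> P X \<longleftrightarrow>
     (\<exists>C q. coproduct \<Sigma> P X C q \<and> (\<forall>A\<in>X. inj_on (q A) (carrier A)))"

definition absolutely_directed ::
    "'u itself \<Rightarrow> ('a \<Rightarrow> 'a \<Rightarrow> bool) \<Rightarrow> 'a set \<Rightarrow> bool" where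
  "absolutely_directed U le K \<longleftrightarrow>
     (\<forall>X. X \<subseteq> K \<and> small U X \<longrightarrow> (\<exists>B\<in>K. \<forall>A\<in>X. le A B))"

end

theory Submission
  imports Defs
begin

text \<open>
  Coproducts exist in a prevariety, being quotients of small term algebras; hence a set of algebras
  is compatible iff its members all embed in one member of \<open>P\<close>.

  If \<open>P\<close> is generated by a directed class \<open>K\<close>, each member of a set of nontrivial algebras embeds in
  a product of members of \<open>K\<close>; these all embed in a single \<open>C\<close> in \<open>K\<close>, so that one power of \<open>C\<close>
  contains all the given algebras. Conversely, compatibility of all sets makes the nontrivial
  members of \<open>P\<close> a directed class.

  In a quasivariety, compatibility of pairs gives compatibility of finite sets, and an ultraproduct
  over the finite subsets of a set gives compatibility of the set. For fixed \<open>B\<close> in \<open>P\<close>, the algebras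
  which are trivial or share an extension in \<open>P\<close> with \<open>B\<close> form a quasivariety, so that joint
  embeddability extends from the generators to all pairs. Finally, every algebra embeds in an
  ultraproduct of its finitely generated subalgebras, which up to isomorphism form a set; an algebra
  of \<open>P\<close> containing all of the nontrivial ones generates \<open>P\<close> as a quasivariety.
\<close>

subsection \<open>Small sets and ultrafilters\<close>

text \<open>Two degenerate algebras cause most of the case distinctions. A trivial algebra embeds in
  \<open>D\<close> only when \<open>D\<close> has a one-element subalgebra; yet trivial algebras are
  empty products and lie in every prevariety, so a prevariety defined by joint embeddability must
  admit them separately. The empty algebra counts as nontrivial, embeds in everything, even in a
  trivial algebra, and offers no pair of distinct elements from which to find a nontrivial factor;
  it is treated apart.

  Products, ultraproducts and term algebras have carriers outside \<open>'u\<close>, whereas members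
  of \<open>P\<close> live on \<open>'u\<close>. The constructions are therefore handled through
  maps: a jointly injective family, \<open>separating\<close>, stands for an embedding into a
  product, and \<open>almost_embedding\<close> for one into an ultraproduct.
  \<open>Prod_embeds\<close> and \<open>Ultraprod_embeds\<close> then supply one algebra on
  \<open>'u\<close> into which every algebra with such a family embeds. That this algebra is fixed
  before the families are given is what produces common extensions.\<close>

lemma small_lepoll:
  "small TYPE('u) A \<Longrightarrow> B \<lesssim> A \<Longrightarrow> small TYPE('u) B"
  unfolding small_def by (rule lesspoll_trans1)

lemma small_subset:
  "small TYPE('u) A \<Longrightarrow> B \<subseteq> A \<Longrightarrow> small TYPE('u) B"
  by (rule small_lepoll[OF _ subset_imp_lepoll])

lemma small_image: "small TYPE('u) A \<Longrightarrow> small TYPE('u) (f ` A)"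
  by (rule small_lepoll[OF _ image_lepoll])

lemma small_inj_on: "inj_on f B \<Longrightarrow> f ` B \<subseteq> A \<Longrightarrow> small TYPE('u) A \<Longrightarrow> small TYPE('u) B"
  by (rule small_lepoll[of A]) (auto simp: lepoll_def)

lemma small_code:
  assumes "small TYPE('u) (A :: 'a set)"
  obtains g :: "'a \<Rightarrow> 'u" where "inj_on g A"
  using assms unfolding small_def lesspoll_def lepoll_def by blast

section \<open>Cardinal arithmetic below an inaccessible cardinal\<close>

locale inaccessible_universe =
  fixes U :: "'u itself"
  assumes inaccessible: "inaccessible TYPE('u)"
begin

lemma small_nat: "small TYPE('u) (UNIV :: nat set)"
  using inaccessible by (simp add: inaccessible_def)

lemma small_UN_universe:
  fixes A :: "'u set" and B :: "'u \<Rightarrow> 'u set"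
  assumes "small TYPE('u) A" and "\<And>a. a \<in> A \<Longrightarrow> small TYPE('u) (B a)"
  shows "small TYPE('u) (\<Union>a\<in>A. B a)"
proof -
  have "\<forall>(A :: 'u set) (B :: 'u \<Rightarrow> 'u set).
      small TYPE('u) A \<and> (\<forall>a\<in>A. small TYPE('u) (B a)) \<longrightarrow> small TYPE('u) (\<Union>a\<in>A. B a)"
    using inaccessible unfolding inaccessible_def by (elim conjE)
  then show ?thesis
    using assms by (elim allE impE) auto
qed

lemma infinite_universe: "infinite (UNIV :: 'u set)"
  using small_nat by (simp add: small_def infinite_le_lepoll lesspoll_imp_lepoll)

lemma small_finite: "finite A \<Longrightarrow> small TYPE('u) A"
  unfolding small_def using finite_lesspoll_infinite[OF infinite_universe] .

lemma small_Pow: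
  assumes "small TYPE('u) A"
  shows "small TYPE('u) (Pow A)"
proof -
  obtain g :: "'a \<Rightarrow> 'u" where g: "inj_on g A"
    using small_code[OF assms] .
  have "small TYPE('u) (Pow (g ` A))"
    using inaccessible small_image[OF assms] by (auto simp: inaccessible_def)
  moreover have "inj_on ((`) g) (Pow A)"
    using g by (rule inj_on_image_Pow)
  ultimately show ?thesis
    by (rule small_inj_on[rotated 2]) auto
qed

text \<open>Regularity is available only for subsets of \<open>'u\<close> indexed by a subset of
  \<open>'u\<close>. Indices and fibres are therefore coded into \<open>'u\<close>, and the codes
  are paired by an injection of \<open>'u \<times> 'u\<close> into \<open>'u\<close>, which exists
  because \<open>'u\<close> is infinite.\<close>

lemma small_Sigma:
  fixes I :: "'a set" and B :: "'a \<Rightarrow> 'b set"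
  assumes I: "small TYPE('u) I" and B: "\<And>i. i \<in> I \<Longrightarrow> small TYPE('u) (B i)"
  shows "small TYPE('u) (Sigma I B)"
proof -
  obtain g :: "'a \<Rightarrow> 'u" where g: "inj_on g I"
    using small_code[OF I] .
  have "\<forall>i\<in>I. \<exists>k :: 'b \<Rightarrow> 'u. inj_on k (B i)"
    using small_code[OF B] by metis
  then obtain k :: "'a \<Rightarrow> 'b \<Rightarrow> 'u" where k: "\<And>i. i \<in> I \<Longrightarrow> inj_on (k i) (B i)"
    by metis
  have "(UNIV :: 'u set) \<times> (UNIV :: 'u set) \<lesssim> (UNIV :: 'u set)"
    using card_of_Times_same_infinite[OF infinite_universe]
    by (intro eqpoll_imp_lepoll) (simp add: eqpoll_iff_card_of_ordIso)
  then obtain p :: "'u \<times> 'u \<Rightarrow> 'u" where p: "inj p"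
    by (auto simp: lepoll_def)
  \<comment> \<open>The coded fibre over the index whose code is \<open>j\<close>; the index is part
    of the code, so different fibres stay disjoint.\<close>
  define C where "C j = (\<lambda>b. p (j, k (inv_into I g j) b)) ` B (inv_into I g j)" for j
  have "small TYPE('u) (C j)" if "j \<in> g ` I" for j
    unfolding C_def using that by (intro small_image B) (auto intro: inv_into_into)
  then have "small TYPE('u) (\<Union>j\<in>g ` I. C j)"
    by (rule small_UN_universe[OF small_image[OF I]])
  moreover have "inj_on (\<lambda>(i, b). p (g i, k i b)) (Sigma I B)"
  proof (rule inj_onI, clarify)
    fix i b j c
    assume ib: "i \<in> I" "b \<in> B i" and jc: "j \<in> I" "c \<in> B j" and "p (g i, k i b) = p (g j, k j c)"
    then have "g i = g j" "k i b = k j c"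
      using injD[OF p] by blast+
    then show "i = j \<and> b = c"
      using ib jc g k[of i] by (metis inj_onD)
  qed
  moreover have "(\<lambda>(i, b). p (g i, k i b)) ` Sigma I B \<subseteq> (\<Union>j\<in>g ` I. C j)"
  proof clarify
    fix i b assume "i \<in> I" "b \<in> B i"
    then have "p (g i, k i b) \<in> C (g i)"
      using g by (simp add: C_def)
    then show "p (g i, k i b) \<in> (\<Union>j\<in>g ` I. C j)"
      using \<open>i \<in> I\<close> by blast
  qed
  ultimately show ?thesis
    by (rule small_inj_on[rotated 2])
qed

lemma small_UN:
  assumes "small TYPE('u) I" and "\<And>i. i \<in> I \<Longrightarrow> small TYPE('u) (B i)"
  shows "small TYPE('u) (\<Union>i\<in>I. B i)"
proof -
  have "(\<Union>i\<in>I. B i) = snd ` Sigma I B"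
    by force
  then show ?thesis
    using small_image[OF small_Sigma[OF assms]] by simp
qed

lemma small_Times:
  "small TYPE('u) A \<Longrightarrow> small TYPE('u) B \<Longrightarrow> small TYPE('u) (A \<times> B)"
  by (rule small_Sigma)

lemma small_Un: "small TYPE('u) A \<Longrightarrow> small TYPE('u) B \<Longrightarrow> small TYPE('u) (A \<union> B)"
  using small_UN[of "{True, False}" "\<lambda>b. if b then A else B"] by (auto simp: small_finite Un_commute)

lemma small_insert: "small TYPE('u) A \<Longrightarrow> small TYPE('u) (insert a A)"
  using small_Un[of "{a}" A] by (simp add: small_finite)

text \<open>An extensional function is determined by its graph, a subset of
  \<open>Sigma I B\<close>; so the strong limit property suffices.\<close>

lemma small_PiE:
  assumes "small TYPE('u) I" and "\<And>i. i \<in> I \<Longrightarrow> small TYPE('u) (B i)"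
  shows "small TYPE('u) (Pi\<^sub>E I B)"
proof (rule small_inj_on)
  show "inj_on (\<lambda>x. (\<lambda>i. (i, x i)) ` I) (Pi\<^sub>E I B)"
  proof (rule inj_onI)
    fix x y
    assume x: "x \<in> Pi\<^sub>E I B" and y: "y \<in> Pi\<^sub>E I B"
      and eq: "(\<lambda>i. (i, x i)) ` I = (\<lambda>i. (i, y i)) ` I"
    have "x i = y i" if "i \<in> I" for i
    proof -
      have "(i, x i) \<in> (\<lambda>i. (i, y i)) ` I"
        using that eq by blast
      then show ?thesis by auto
    qed
    then show "x = y"
      using x y by (rule PiE_ext[rotated 2])
  qed
  show "(\<lambda>x. (\<lambda>i. (i, x i)) ` I) ` Pi\<^sub>E I B \<subseteq> Pow (Sigma I B)"
    by (auto simp: PiE_def)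
qed (intro small_Pow small_Sigma assms)

text \<open>Uncountability enters here: the union runs over all lengths, and their set must itself
  be small.\<close>

lemma small_lists:
  assumes "small TYPE('u) A"
  shows "small TYPE('u) (lists A)"
proof -
  have "small TYPE('u) {xs \<in> lists A. length xs = n}" for n
  proof (induction n)
    case 0
    have "{xs \<in> lists A. length xs = 0} = {[]}" by auto
    then show ?case by (simp add: small_finite)
  next
    case (Suc n)
    have "{xs \<in> lists A. length xs = Suc n} \<subseteq> (\<lambda>(x, xs). x # xs) ` (A \<times> {xs \<in> lists A. length xs = n})"
      by (force simp: length_Suc_conv)
    then show ?case
      by (rule small_subset[rotated]) (intro small_image small_Times assms Suc)
  qed
  then have "small TYPE('u) (\<Union>n. {xs \<in> lists A. length xs = n})"
    by (intro small_UN small_nat)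
  then show ?thesis
    by (rule small_subset) auto
qed

end

section \<open>The ultrafilter lemma and ultrafilters on finite subsets\<close>

lemma ultrafilter_extension:
  fixes F :: "'a filter"
  assumes "F \<noteq> bot"
  obtains G where "G \<noteq> bot" "G \<le> F" "\<And>Q. eventually Q G \<or> eventually (\<lambda>x. \<not> Q x) G"
proof -
  let ?A = "{G. G \<noteq> bot \<and> G \<le> F}" and ?P = "\<lambda>G H :: 'a filter. H \<le> G"
  have "\<exists>G\<in>?A. \<forall>H\<in>?A. ?P G H \<longrightarrow> H = G"
  proof (rule predicate_Zorn)
    show "partial_order_on ?A (relation_of ?P ?A)"
      by (rule partial_order_on_relation_ofI) auto
    fix C assume "C \<in> Chains (relation_of ?P ?A)"
    then have C: "C \<subseteq> ?A" and total: "\<And>G H. G \<in> C \<Longrightarrow> H \<in> C \<Longrightarrow> G \<le> H \<or> H \<le> G"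
      by (auto simp: Chains_def relation_of_def)
    show "\<exists>u\<in>?A. \<forall>G\<in>C. u \<le> G"
    proof (cases "C = {}")
      case False
      \<comment> \<open>In a chain the smaller of two filters is their infimum, so \<open>C\<close>
        is a base of its infimum: \<open>False\<close> holds eventually there only if it does in
        some member, and all members are proper.\<close>
      have "\<exists>x\<in>C. x \<le> inf G H" if "G \<in> C" "H \<in> C" for G H
        using that total[OF that] by (auto simp: inf_absorb1 inf_absorb2)
      then have "eventually (\<lambda>_. False) (Inf C) \<longleftrightarrow> (\<exists>G\<in>C. eventually (\<lambda>_. False) G)"
        by (rule eventually_Inf_base[OF False])
      then have "Inf C \<noteq> bot"
        using C by (auto simp: trivial_limit_def)
      moreover have "Inf C \<le> F"
        using False C by (auto intro: Inf_lower2)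
      ultimately show ?thesis
        by (auto intro: Inf_lower)
    qed (use assms in auto)
  qed
  then obtain G where G: "G \<noteq> bot" "G \<le> F"
    and max: "\<And>H. H \<noteq> bot \<Longrightarrow> H \<le> F \<Longrightarrow> H \<le> G \<Longrightarrow> H = G"
    by auto
  have "eventually Q G \<or> eventually (\<lambda>x. \<not> Q x) G" for Q
  \<comment> \<open>Either adding the set of \<open>Q\<close> to \<open>G\<close> keeps it proper,
    and maximality puts \<open>Q\<close> into \<open>G\<close> already, or it yields the improper
    filter, which says that the complement belongs to \<open>G\<close>.\<close>
  proof (cases "inf G (principal {x. Q x}) = bot")
    case True
    then have "eventually (\<lambda>_. False) (inf G (principal {x. Q x}))"
      by simp
    then show ?thesis
      by (simp add: eventually_inf_principal)
  next
    case False
    then have "inf G (principal {x. Q x}) = G"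
      using G(2) by (intro max) (auto intro: le_infI1)
    moreover have "eventually Q (inf G (principal {x. Q x}))"
      by (simp add: eventually_inf_principal)
    ultimately show ?thesis by simp
  qed
  then show thesis
    using that G by blast
qed

text \<open>The sets of finite \<open>S\<close> containing a given element have the finite
  intersection property. Data available only for those \<open>S\<close> that contain
  \<open>a\<close> is thus available almost everywhere, for each \<open>a\<close>
  separately.\<close>

lemma ultrafilter_on_finite_subsets:
  obtains F where "ultrafilter_on {S. finite S \<and> S \<subseteq> A} F"
    and "\<And>a. a \<in> A \<Longrightarrow> eventually (\<lambda>S. a \<in> S) F"
proof -
  obtain G where G: "G \<noteq> bot" "G \<le> finite_subsets_at_top A"
    and ultra: "\<And>Q. eventually Q G \<or> eventually (\<lambda>x. \<not> Q x) G"
    using ultrafilter_extension[OF finite_subsets_at_top_neq_bot] by blast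
  have "G \<le> principal {S. finite S \<and> S \<subseteq> A}"
    using G(2) by (rule order_trans)
      (auto simp: le_principal intro: eventually_finite_subsets_at_top_weakI)
  moreover have "eventually (\<lambda>S. a \<in> S) G" if "a \<in> A" for a
    by (rule filter_leD[OF G(2)])
      (use that in \<open>auto simp: eventually_finite_subsets_at_top intro!: exI[of _ "{a}"]\<close>)
  ultimately show thesis
    using that G(1) ultra by (auto simp: ultrafilter_on_def)
qed

lemma ultrafilter_on_filtermap:
  assumes "ultrafilter_on I F"
  shows "ultrafilter_on (g ` I) (filtermap g F)"
proof -
  have "\<forall>\<^sub>F i in F. i \<in> I"
    using assms by (simp add: ultrafilter_on_def le_principal)
  then have "\<forall>\<^sub>F i in F. g i \<in> g ` I"
    by (rule eventually_mono) blast
  then show ?thesis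
    using assms by (simp add: ultrafilter_on_def filtermap_bot_iff le_principal eventually_filtermap)
qed

lemma ultrafilter_on_in: "ultrafilter_on I F \<Longrightarrow> \<forall>\<^sub>F i in F. i \<in> I"
  by (simp add: ultrafilter_on_def le_principal)

lemma ultrafilter_on_not:
  assumes "ultrafilter_on I F"
  shows "\<not> eventually Q F \<longleftrightarrow> (\<forall>\<^sub>F i in F. \<not> Q i)"
proof -
  have "\<not> (eventually Q F \<and> (\<forall>\<^sub>F i in F. \<not> Q i))"
    using assms eventually_conj[of Q F "\<lambda>i. \<not> Q i"] by (auto simp: ultrafilter_on_def trivial_limit_def)
  then show ?thesis
    using assms unfolding ultrafilter_on_def by blast
qed


subsection \<open>Homomorphisms and products\<close>

lemma restrict_comp_PiE:
  assumes "x \<in> J \<rightarrow>\<^sub>E C" and "\<And>c. c \<in> C \<Longrightarrow> h c \<in> D"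
  shows "(\<lambda>k \<in> J. h (x k)) \<in> J \<rightarrow>\<^sub>E D"
  using assms by (auto dest: PiE_mem)

lemma algebra_closed:
  assumes "algebra \<Sigma> A" "f \<in> symbols \<Sigma>" "x \<in> arity \<Sigma> f \<rightarrow>\<^sub>E carrier A"
  shows "oper A f x \<in> carrier A"
proof -
  have "oper A f \<in> (arity \<Sigma> f \<rightarrow>\<^sub>E carrier A) \<rightarrow>\<^sub>E carrier A"
    using assms(1,2) unfolding algebra_def by (rule PiE_mem)
  then show ?thesis
    using assms(3) by (rule PiE_mem)
qed

lemma subset_algebrasD:
  fixes X :: "('f, 'i, 'u) algebra set"
  assumes "X \<subseteq> algebras \<Sigma>" "A \<in> X"
  shows "algebra \<Sigma> A" "small TYPE('u) (carrier A)"
  using assms by (auto simp: algebras_def)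

lemma hom_closed: "h \<in> hom \<Sigma> A B \<Longrightarrow> a \<in> carrier A \<Longrightarrow> h a \<in> carrier B"
  by (auto simp: hom_def)

lemma hom_oper:
  "h \<in> hom \<Sigma> A B \<Longrightarrow> f \<in> symbols \<Sigma> \<Longrightarrow> x \<in> arity \<Sigma> f \<rightarrow>\<^sub>E carrier A \<Longrightarrow>
    h (oper A f x) = oper B f (\<lambda>k \<in> arity \<Sigma> f. h (x k))"
  by (simp add: hom_def)

lemma homI:
  assumes "\<And>a. a \<in> carrier A \<Longrightarrow> h a \<in> carrier B"
    and "\<And>f x. f \<in> symbols \<Sigma> \<Longrightarrow> x \<in> arity \<Sigma> f \<rightarrow>\<^sub>E carrier A \<Longrightarrow>
      h (oper A f x) = oper B f (\<lambda>k \<in> arity \<Sigma> f. h (x k))"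
    and "algebra \<Sigma> A"
  shows "restrict h (carrier A) \<in> hom \<Sigma> A B"
proof -
  have "restrict h (carrier A) (oper A f x) = oper B f (\<lambda>k \<in> arity \<Sigma> f. restrict h (carrier A) (x k))"
    if "f \<in> symbols \<Sigma>" "x \<in> arity \<Sigma> f \<rightarrow>\<^sub>E carrier A" for f x
  proof -
    have "(\<lambda>k \<in> arity \<Sigma> f. restrict h (carrier A) (x k)) = (\<lambda>k \<in> arity \<Sigma> f. h (x k))"
      using that by (intro restrict_ext) (auto dest: PiE_mem)
    then show ?thesis
      using that assms algebra_closed by fastforce
  qed
  then show ?thesis
    using assms(1) by (simp add: hom_def)
qed

lemma hom_eqI:
  "g \<in> hom \<Sigma> A B \<Longrightarrow> h \<in> hom \<Sigma> A B \<Longrightarrow> (\<And>a. a \<in> carrier A \<Longrightarrow> g a = h a) \<Longrightarrow> g = h"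
  by (auto simp: hom_def intro: PiE_ext)

lemma hom_compose:
  assumes A: "algebra \<Sigma> A" and h: "h \<in> hom \<Sigma> A B" and g: "g \<in> hom \<Sigma> B C"
  shows "compose (carrier A) g h \<in> hom \<Sigma> A C"
  unfolding compose_def
proof (rule homI[OF _ _ A])
  fix f x assume f: "f \<in> symbols \<Sigma>" and x: "x \<in> arity \<Sigma> f \<rightarrow>\<^sub>E carrier A"
  have "(\<lambda>k \<in> arity \<Sigma> f. h (x k)) \<in> arity \<Sigma> f \<rightarrow>\<^sub>E carrier B"
    using x hom_closed[OF h] by (auto dest: PiE_mem)
  then have "g (h (oper A f x)) = oper C f (\<lambda>k \<in> arity \<Sigma> f. g ((\<lambda>k \<in> arity \<Sigma> f. h (x k)) k))"
    using hom_oper[OF h f x] hom_oper[OF g f] by simp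
  also have "(\<lambda>k \<in> arity \<Sigma> f. g ((\<lambda>k \<in> arity \<Sigma> f. h (x k)) k)) = (\<lambda>k \<in> arity \<Sigma> f. g (h (x k)))"
    by (rule restrict_ext) simp
  finally show "g (h (oper A f x)) = oper C f (\<lambda>k \<in> arity \<Sigma> f. g (h (x k)))" .
qed (use hom_closed[OF h] hom_closed[OF g] in blast)

lemma embeddable_refl: "algebra \<Sigma> A \<Longrightarrow> embeddable \<Sigma> A A"
  unfolding embeddable_def
proof
  assume A: "algebra \<Sigma> A"
  show "restrict (\<lambda>a. a) (carrier A) \<in> hom \<Sigma> A A"
    by (rule homI) (auto simp: A PiE_restrict)
qed (simp add: inj_on_def)

lemma embeddable_trans:
  assumes A: "algebra \<Sigma> A" and "embeddable \<Sigma> A B" "embeddable \<Sigma> B C"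
  shows "embeddable \<Sigma> A C"
proof -
  obtain h g where h: "h \<in> hom \<Sigma> A B" "inj_on h (carrier A)"
    and g: "g \<in> hom \<Sigma> B C" "inj_on g (carrier B)"
    using assms unfolding embeddable_def by blast
  have "inj_on (compose (carrier A) g h) (carrier A)"
    using h g hom_closed[OF h(1)] by (simp add: inj_on_def compose_def)
  then show ?thesis
    unfolding embeddable_def using hom_compose[OF A h(1) g(1)] by blast
qed

lemma isomorphic_imp_embeddable: "isomorphic \<Sigma> A B \<Longrightarrow> embeddable \<Sigma> A B"
  unfolding isomorphic_def embeddable_def bij_betw_def by blast

lemma isomorphic_sym:
  assumes A: "algebra \<Sigma> A" and B: "algebra \<Sigma> B" and "isomorphic \<Sigma> A B"
  shows "isomorphic \<Sigma> B A"
proof -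
  obtain h where h: "h \<in> hom \<Sigma> A B" and bij: "bij_betw h (carrier A) (carrier B)"
    using assms unfolding isomorphic_def by blast
  let ?k = "inv_into (carrier A) h"
  have k: "?k b \<in> carrier A" "h (?k b) = b" if "b \<in> carrier B" for b
    using that bij by (auto simp: bij_betw_def inv_into_into f_inv_into_f)
  have "restrict ?k (carrier B) \<in> hom \<Sigma> B A"
  proof (rule homI[OF _ _ B])
    fix f x assume f: "f \<in> symbols \<Sigma>" and x: "x \<in> arity \<Sigma> f \<rightarrow>\<^sub>E carrier B"
    let ?y = "\<lambda>j \<in> arity \<Sigma> f. ?k (x j)"
    have y: "?y \<in> arity \<Sigma> f \<rightarrow>\<^sub>E carrier A"
      using x k by (auto dest: PiE_mem)
    have "(\<lambda>j \<in> arity \<Sigma> f. h (?y j)) = x"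
      using x k by (intro PiE_ext[of _ "arity \<Sigma> f" "\<lambda>_. carrier B"]) (auto dest: PiE_mem)
    then have "h (oper A f ?y) = oper B f x"
      using hom_oper[OF h f y] by simp
    then show "?k (oper B f x) = oper A f ?y"
      using algebra_closed[OF A f y] bij by (metis bij_betw_inv_into_left)
  qed (rule k)
  moreover have "bij_betw (restrict ?k (carrier B)) (carrier B) (carrier A)"
    using bij_betw_inv_into[OF bij] by (simp add: bij_betw_restrict_eq)
  ultimately show ?thesis
    unfolding isomorphic_def by blast
qed

lemma embeddable_empty:
  assumes A: "algebra \<Sigma> A" and "carrier A = {}"
  shows "embeddable \<Sigma> A B"
proof -
  have "restrict undefined (carrier A) \<in> hom \<Sigma> A B"
    using algebra_closed[OF A] assms(2) by (intro homI[OF _ _ A]) blast+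
  then show ?thesis
    using assms(2) unfolding embeddable_def by fastforce
qed

text \<open>An injection into one point leaves at most one element, and an algebra with at most one
  element that is not trivial is empty.\<close>

lemma embeddable_in_trivial:
  "embeddable \<Sigma> A B \<Longrightarrow> trivial B \<Longrightarrow> \<not> trivial A \<Longrightarrow> carrier A = {}"
  unfolding embeddable_def trivial_def hom_def by (fastforce simp: inj_on_def)

lemma not_trivialE:
  assumes "\<not> trivial A" "carrier A \<noteq> {}"
  obtains a b where "a \<in> carrier A" "b \<in> carrier A" "a \<noteq> b"
  using assms unfolding trivial_def by blast

lemma hom_to_trivial:
  assumes "algebra \<Sigma> A" "algebra \<Sigma> B" "carrier B = {b}"
  shows "(\<lambda>a \<in> carrier A. b) \<in> hom \<Sigma> A B"
proof (rule homI[OF _ _ assms(1)])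
  fix f x assume "f \<in> symbols \<Sigma>" "x \<in> arity \<Sigma> f \<rightarrow>\<^sub>E carrier A"
  then have "oper B f (\<lambda>k \<in> arity \<Sigma> f. b) \<in> carrier B"
    using assms(3) by (intro algebra_closed[OF assms(2)]) auto
  then show "b = oper B f (\<lambda>k \<in> arity \<Sigma> f. b)"
    using assms(3) by simp
qed (use assms in simp)

text \<open>The image of an embedding is a subalgebra isomorphic to the source. From here on,
  closure under \<open>Sub\<close> is used only as closure under embeddings.\<close>

lemma Sub_iff:
  assumes "X \<subseteq> algebras \<Sigma>"
  shows "A \<in> Sub \<Sigma> X \<longleftrightarrow> A \<in> algebras \<Sigma> \<and> (\<exists>B\<in>X. embeddable \<Sigma> A B)"
proof (rule iffI)
  assume "A \<in> Sub \<Sigma> X"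
  then obtain B C where A: "A \<in> algebras \<Sigma>" and B: "B \<in> X" and C: "subalgebra \<Sigma> C B"
    and AC: "isomorphic \<Sigma> A C"
    by (auto simp: Sub_def)
  have alg: "algebra \<Sigma> C"
    using C by (simp add: subalgebra_def)
  have "restrict (\<lambda>a. a) (carrier C) \<in> hom \<Sigma> C B"
    using C by (intro homI) (auto simp: subalgebra_def PiE_restrict)
  then have "embeddable \<Sigma> C B"
    unfolding embeddable_def by (rule rev_bexI) (simp add: inj_on_def)
  then show "A \<in> algebras \<Sigma> \<and> (\<exists>B\<in>X. embeddable \<Sigma> A B)"
    using A B embeddable_trans[OF _ isomorphic_imp_embeddable[OF AC]] by (auto simp: algebras_def)
next
  assume "A \<in> algebras \<Sigma> \<and> (\<exists>B\<in>X. embeddable \<Sigma> A B)"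
  then obtain B h where A: "A \<in> algebras \<Sigma>" and B: "B \<in> X" and h: "h \<in> hom \<Sigma> A B" "inj_on h (carrier A)"
    by (auto simp: embeddable_def)
  define E where "E = h ` carrier A"
  define C where "C = \<lparr>carrier = E, oper = (\<lambda>f \<in> symbols \<Sigma>. \<lambda>x \<in> arity \<Sigma> f \<rightarrow>\<^sub>E E. oper B f x)\<rparr>"
  have A': "algebra \<Sigma> A"
    using A by (simp add: algebras_def)
  have E: "E \<subseteq> carrier B"
    using hom_closed[OF h(1)] by (auto simp: E_def)
  have closed: "oper B f x \<in> E" if f: "f \<in> symbols \<Sigma>" and x: "x \<in> arity \<Sigma> f \<rightarrow>\<^sub>E E" for f x
  proof -
    \<comment> \<open>Chosen preimages of the arguments: the value at \<open>x\<close> is the image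
      of the value at \<open>?y\<close>, so the image of \<open>h\<close> is closed.\<close>
    let ?y = "\<lambda>k \<in> arity \<Sigma> f. inv_into (carrier A) h (x k)"
    have y: "?y \<in> arity \<Sigma> f \<rightarrow>\<^sub>E carrier A"
      using x by (auto simp: E_def intro!: inv_into_into dest: PiE_mem)
    have "(\<lambda>k \<in> arity \<Sigma> f. h (?y k)) = x"
      using x by (intro PiE_ext[of _ "arity \<Sigma> f" "\<lambda>_. E"])
        (auto simp: E_def f_inv_into_f dest: PiE_mem)
    then show ?thesis
      using hom_oper[OF h(1) f y] algebra_closed[OF A' f y] by (force simp: E_def)
  qed
  have "subalgebra \<Sigma> C B"
    using E closed unfolding subalgebra_def algebra_def C_def by auto
  moreover have "isomorphic \<Sigma> A C"
    unfolding isomorphic_def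
  proof
    have "(\<lambda>k \<in> arity \<Sigma> f. h (x k)) \<in> arity \<Sigma> f \<rightarrow>\<^sub>E E"
      if "x \<in> arity \<Sigma> f \<rightarrow>\<^sub>E carrier A" for f x
      using that by (auto simp: E_def dest: PiE_mem)
    then show "h \<in> hom \<Sigma> A C"
      using h(1) by (auto simp: hom_def C_def E_def)
    show "bij_betw h (carrier A) (carrier C)"
      using h(2) by (simp add: bij_betw_def C_def E_def)
  qed
  ultimately show "A \<in> Sub \<Sigma> X"
    using A B by (auto simp: Sub_def)
qed

lemma carrier_product [simp]: "carrier (product \<Sigma> I B) = (\<Pi>\<^sub>E i \<in> I. carrier (B i))"
  by (simp add: product_def)

lemma oper_product:
  "f \<in> symbols \<Sigma> \<Longrightarrow> x \<in> arity \<Sigma> f \<rightarrow>\<^sub>E carrier (product \<Sigma> I B) \<Longrightarrow>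
    oper (product \<Sigma> I B) f x = (\<lambda>i \<in> I. oper (B i) f (\<lambda>k \<in> arity \<Sigma> f. x k i))"
  by (simp add: product_def)

lemma algebra_product:
  assumes "\<And>i. i \<in> I \<Longrightarrow> algebra \<Sigma> (B i)"
  shows "algebra \<Sigma> (product \<Sigma> I B)"
proof -
  have "oper (B i) f (\<lambda>k \<in> arity \<Sigma> f. x k i) \<in> carrier (B i)"
    if "i \<in> I" "f \<in> symbols \<Sigma>" "x \<in> arity \<Sigma> f \<rightarrow>\<^sub>E (\<Pi>\<^sub>E i \<in> I. carrier (B i))" for i f x
    using that by (intro algebra_closed[OF assms]) (auto dest!: PiE_mem)
  then show ?thesis
    by (auto simp: algebra_def product_def)
qed

lemma hom_product_proj:
  assumes "\<And>i. i \<in> I \<Longrightarrow> algebra \<Sigma> (B i)" "i \<in> I"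
  shows "(\<lambda>x \<in> carrier (product \<Sigma> I B). x i) \<in> hom \<Sigma> (product \<Sigma> I B) (B i)"
  using assms by (intro homI algebra_product) (auto simp: oper_product simp del: carrier_product, auto)

text \<open>An embedding into a product, read coordinatewise. For \<open>I = {}\<close> it says that
  \<open>A\<close> has at most one element, which accounts for the empty product. The index type is
  free, so that pairs of terms or natural numbers can serve as indices.\<close>

definition separating ::
    "('f, 'i) signature \<Rightarrow> 'j set \<Rightarrow> ('f, 'i, 'a) algebra \<Rightarrow> ('j \<Rightarrow> ('f, 'i, 'b) algebra)
      \<Rightarrow> ('j \<Rightarrow> 'a \<Rightarrow> 'b) \<Rightarrow> bool" where
  "separating \<Sigma> I A B h \<longleftrightarrow>
     (\<forall>i\<in>I. h i \<in> hom \<Sigma> A (B i)) \<and>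
     (\<forall>a\<in>carrier A. \<forall>b\<in>carrier A. (\<forall>i\<in>I. h i a = h i b) \<longrightarrow> a = b)"

lemma embeddable_product:
  assumes A: "algebra \<Sigma> A" and sep: "separating \<Sigma> I A B h"
  shows "embeddable \<Sigma> A (product \<Sigma> I B)"
  unfolding embeddable_def
proof
  have h: "h i \<in> hom \<Sigma> A (B i)" if "i \<in> I" for i
    using sep that by (simp add: separating_def)
  show "(\<lambda>a \<in> carrier A. \<lambda>i \<in> I. h i a) \<in> hom \<Sigma> A (product \<Sigma> I B)"
  proof (rule homI[OF _ _ A])
    fix f x assume f: "f \<in> symbols \<Sigma>" and x: "x \<in> arity \<Sigma> f \<rightarrow>\<^sub>E carrier A"
    have y: "(\<lambda>k \<in> arity \<Sigma> f. \<lambda>i \<in> I. h i (x k)) \<in> arity \<Sigma> f \<rightarrow>\<^sub>E carrier (product \<Sigma> I B)"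
      using x hom_closed[OF h] by (auto dest: PiE_mem)
    have "h i (oper A f x) = oper (B i) f (\<lambda>k \<in> arity \<Sigma> f. (\<lambda>k \<in> arity \<Sigma> f. \<lambda>i \<in> I. h i (x k)) k i)"
      if i: "i \<in> I" for i
      using hom_oper[OF h[OF i] f x] i by (simp cong: restrict_cong)
    then show "(\<lambda>i \<in> I. h i (oper A f x)) =
        oper (product \<Sigma> I B) f (\<lambda>k \<in> arity \<Sigma> f. \<lambda>i \<in> I. h i (x k))"
      unfolding oper_product[OF f y] by (intro restrict_ext) simp
  qed (use hom_closed[OF h] in auto)
  show "inj_on (\<lambda>a \<in> carrier A. \<lambda>i \<in> I. h i a) (carrier A)"
    using sep by (auto simp: inj_on_def separating_def) (metis restrict_apply')
qed

lemma Prod_separating: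
  fixes A :: "('f, 'i, 'u) algebra"
  assumes "A \<in> Prod \<Sigma> X" "X \<subseteq> algebras \<Sigma>"
  obtains I :: "'u set" and B h
  where "small TYPE('u) I" "\<And>i. i \<in> I \<Longrightarrow> B i \<in> X" "separating \<Sigma> I A B h"
proof -
  obtain I :: "'u set" and B where I: "small TYPE('u) I" and B: "\<And>i. i \<in> I \<Longrightarrow> B i \<in> X"
    and iso: "isomorphic \<Sigma> A (product \<Sigma> I B)" and A: "A \<in> algebras \<Sigma>"
    using assms(1) by (auto simp: Prod_def)
  obtain g where g: "g \<in> hom \<Sigma> A (product \<Sigma> I B)" "inj_on g (carrier A)"
    using iso by (auto simp: isomorphic_def bij_betw_def)
  define h where "h i = compose (carrier A) (\<lambda>x \<in> carrier (product \<Sigma> I B). x i) g" for i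
  have "h i \<in> hom \<Sigma> A (B i)" if "i \<in> I" for i
    unfolding h_def using A B assms(2) that
    by (intro hom_compose[OF _ g(1)] hom_product_proj) (auto simp: algebras_def)
  moreover have "a = b"
    if ab: "a \<in> carrier A" "b \<in> carrier A" and eq: "\<forall>i\<in>I. h i a = h i b" for a b
  proof -
    have "g a \<in> carrier (product \<Sigma> I B)" "g b \<in> carrier (product \<Sigma> I B)"
      using hom_closed[OF g(1)] ab by auto
    then have "g a = g b"
      using eq ab unfolding h_def carrier_product
      by (intro PiE_ext[of _ I "\<lambda>i. carrier (B i)"]) (auto simp: compose_def)
    then show "a = b"
      using g(2) ab by (simp add: inj_on_def)
  qed
  ultimately have "separating \<Sigma> I A B h"
    by (simp add: separating_def)
  then show thesis
    using that I B by blast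
qed

lemma prevariety_generated_separating:
  fixes A :: "('f, 'i, 'u) algebra"
  assumes "A \<in> prevariety_generated \<Sigma> X" "X \<subseteq> algebras \<Sigma>"
  obtains I :: "'u set" and B h
  where "small TYPE('u) I" "\<And>i. i \<in> I \<Longrightarrow> B i \<in> X" "separating \<Sigma> I A B h"
proof -
  have "Prod \<Sigma> X \<subseteq> algebras \<Sigma>"
    by (auto simp: Prod_def)
  then obtain D g where A: "A \<in> algebras \<Sigma>" and D: "D \<in> Prod \<Sigma> X"
    and g: "g \<in> hom \<Sigma> A D" "inj_on g (carrier A)"
    using assms(1) by (auto simp: prevariety_generated_def Sub_iff embeddable_def)
  obtain I :: "'u set" and B h where I: "small TYPE('u) I" "\<And>i. i \<in> I \<Longrightarrow> B i \<in> X"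
    and sep: "separating \<Sigma> I D B h"
    using Prod_separating[OF D assms(2)] by blast
  have "separating \<Sigma> I A B (\<lambda>i. compose (carrier A) (h i) g)"
    using sep A g hom_closed[OF g(1)]
    by (auto simp: separating_def algebras_def compose_eq inj_on_def intro: hom_compose)
  then show thesis
    using that I by blast
qed

section \<open>Transport of algebras into the universe\<close>

context inaccessible_universe
begin

text \<open>Transport of structure along an injection of the carrier into \<open>'u\<close>; this is
  how products and ultraproducts return to \<open>algebras\<close>.\<close>

lemma small_copy:
  fixes A :: "('f, 'i, 'a) algebra"
  assumes A: "algebra \<Sigma> A" and "small TYPE('u) (carrier A)"
  obtains A' :: "('f, 'i, 'u) algebra" where "A' \<in> algebras \<Sigma>" "isomorphic \<Sigma> A' A" "isomorphic \<Sigma> A A'"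
proof -
  obtain g :: "'a \<Rightarrow> 'u" where g: "inj_on g (carrier A)"
    using small_code[OF assms(2)] .
  let ?k = "inv_into (carrier A) g"
  define A' where "A' = \<lparr>carrier = g ` carrier A,
    oper = (\<lambda>f \<in> symbols \<Sigma>. \<lambda>x \<in> arity \<Sigma> f \<rightarrow>\<^sub>E g ` carrier A. g (oper A f (\<lambda>k \<in> arity \<Sigma> f. ?k (x k))))\<rparr>"
  have "(\<lambda>k \<in> arity \<Sigma> f. ?k (x k)) \<in> arity \<Sigma> f \<rightarrow>\<^sub>E carrier A"
    if "x \<in> arity \<Sigma> f \<rightarrow>\<^sub>E g ` carrier A" for f x
    using that by (auto intro!: inv_into_into dest: PiE_mem)
  then have alg: "algebra \<Sigma> A'"
    using algebra_closed[OF A] by (auto simp: algebra_def A'_def)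
  have "restrict g (carrier A) \<in> hom \<Sigma> A A'"
  proof (rule homI[OF _ _ A])
    fix f x assume f: "f \<in> symbols \<Sigma>" and x: "x \<in> arity \<Sigma> f \<rightarrow>\<^sub>E carrier A"
    have "(\<lambda>k \<in> arity \<Sigma> f. ?k ((\<lambda>k \<in> arity \<Sigma> f. g (x k)) k)) = x"
      using x g by (intro PiE_ext[of _ "arity \<Sigma> f" "\<lambda>_. carrier A"])
        (auto simp: inv_into_f_f dest: PiE_mem)
    moreover have "(\<lambda>k \<in> arity \<Sigma> f. g (x k)) \<in> arity \<Sigma> f \<rightarrow>\<^sub>E g ` carrier A"
      using x by (auto dest: PiE_mem)
    ultimately show "g (oper A f x) = oper A' f (\<lambda>k \<in> arity \<Sigma> f. g (x k))"
      using f by (simp add: A'_def)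
  qed (simp add: A'_def)
  moreover have "bij_betw (restrict g (carrier A)) (carrier A) (carrier A')"
    using g by (simp add: bij_betw_def A'_def)
  ultimately have "isomorphic \<Sigma> A A'"
    unfolding isomorphic_def by blast
  moreover have "A' \<in> algebras \<Sigma>"
    using alg small_image[OF assms(2)] by (simp add: algebras_def A'_def)
  ultimately show thesis
    using that isomorphic_sym[OF A alg] by blast
qed

text \<open>\<open>D\<close> depends on the factors alone. Two algebras with separating families
  into the same \<open>B\<close> therefore embed in the same \<open>D\<close>, which is how common
  extensions arise. The indices are recoded because \<open>Prod\<close> takes them from
  \<open>'u\<close>.\<close>

lemma Prod_embeds:
  fixes B :: "'j \<Rightarrow> ('f, 'i, 'u) algebra"
  assumes I: "small TYPE('u) I" and B: "\<And>i. i \<in> I \<Longrightarrow> B i \<in> X" and X: "X \<subseteq> algebras \<Sigma>"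
  obtains D where "D \<in> Prod \<Sigma> X"
    "\<And>(A :: ('f, 'i, 'u) algebra) h. algebra \<Sigma> A \<Longrightarrow> separating \<Sigma> I A B h \<Longrightarrow> embeddable \<Sigma> A D"
proof -
  obtain g :: "'j \<Rightarrow> 'u" where g: "inj_on g I"
    using small_code[OF I] .
  define r where "r = inv_into I g"
  have r: "r (g i) = i" if "i \<in> I" for i
    using g that by (simp add: r_def)
  let ?D = "product \<Sigma> (g ` I) (B \<circ> r)"
  have alg: "algebra \<Sigma> ?D"
    using subset_algebrasD(1)[OF X B] r by (intro algebra_product) auto
  have "small TYPE('u) (carrier ?D)"
    unfolding carrier_product
    using subset_algebrasD(2)[OF X B] r by (intro small_PiE small_image I) auto
  then obtain D :: "('f, 'i, 'u) algebra"
    where D: "D \<in> algebras \<Sigma>" "isomorphic \<Sigma> D ?D" "isomorphic \<Sigma> ?D D"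
    using small_copy[OF alg] by metis
  have "\<forall>j \<in> g ` I. (B \<circ> r) j \<in> X"
    using B r by simp
  then have "D \<in> Prod \<Sigma> X"
    using D small_image[OF I, of g] unfolding Prod_def by blast
  moreover have "embeddable \<Sigma> A D" if A: "algebra \<Sigma> A" and "separating \<Sigma> I A B h"
    for A :: "('f, 'i, 'u) algebra" and h
  proof -
    have "separating \<Sigma> (g ` I) A (B \<circ> r) (h \<circ> r)"
      using that(2) r by (auto simp: separating_def)
    then show ?thesis
      using embeddable_product[OF A] embeddable_trans[OF A] isomorphic_imp_embeddable[OF D(3)]
      by blast
  qed
  ultimately show thesis
    using that by blast
qed

lemma prevariety_embeddable:
  "prevariety \<Sigma> P \<Longrightarrow> A \<in> algebras \<Sigma> \<Longrightarrow> B \<in> P \<Longrightarrow> embeddable \<Sigma> A B \<Longrightarrow> A \<in> P"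
  unfolding prevariety_def by (meson Sub_iff subsetD)

lemma prevariety_separating:
  fixes A :: "('f, 'i, 'u) algebra"
  assumes P: "prevariety \<Sigma> P" and A: "A \<in> algebras \<Sigma>" and I: "small TYPE('u) I"
    and B: "\<And>i. i \<in> I \<Longrightarrow> B i \<in> P" and "separating \<Sigma> I A B h"
  shows "A \<in> P"
proof -
  have X: "P \<subseteq> algebras \<Sigma>" "Prod \<Sigma> P \<subseteq> P"
    using P by (auto simp: prevariety_def)
  obtain D where "D \<in> Prod \<Sigma> P"
    and D: "\<And>(A :: ('f, 'i, 'u) algebra) h. algebra \<Sigma> A \<Longrightarrow> separating \<Sigma> I A B h \<Longrightarrow> embeddable \<Sigma> A D"
    using Prod_embeds[where B = B, OF I B X(1)] by blast
  moreover have "embeddable \<Sigma> A D"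
    using A assms(5) by (intro D) (simp_all add: algebras_def)
  ultimately show ?thesis
    using prevariety_embeddable[OF P A] X by blast
qed

text \<open>The empty family separates the points of a one-element algebra.\<close>

lemma prevariety_trivial:
  fixes A :: "('f, 'i, 'u) algebra"
  assumes "prevariety \<Sigma> P" "A \<in> algebras \<Sigma>" "trivial A"
  shows "A \<in> P"
  using assms
  by (intro prevariety_separating[of \<Sigma> P A "{} :: nat set"]) (auto simp: small_finite separating_def trivial_def)

lemma ex_trivial:
  obtains T :: "('f, 'i, 'u) algebra" where "T \<in> algebras \<Sigma>" "trivial T"
proof
  let ?T = "\<lparr>carrier = {undefined},
    oper = (\<lambda>f \<in> symbols \<Sigma>. \<lambda>x \<in> arity \<Sigma> f \<rightarrow>\<^sub>E {undefined}. undefined)\<rparr> :: ('f, 'i, 'u) algebra"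
  show "?T \<in> algebras \<Sigma>"
    by (auto simp: algebras_def algebra_def small_finite)
  show "trivial ?T"
    by (simp add: trivial_def)
qed

end


subsection \<open>Term algebras and coproducts\<close>

datatype ('f, 'i, 'v) tm = Var 'v | Op 'f "'i \<Rightarrow> ('f, 'i, 'v) tm"

text \<open>Children outside the arity are pinned by extensionality. Otherwise terms that differ
  only there would count as distinct, and \<open>labels\<close> could not tell them apart.\<close>

inductive_set terms :: "('f, 'i) signature \<Rightarrow> 'v set \<Rightarrow> ('f, 'i, 'v) tm set"
  for \<Sigma> :: "('f, 'i) signature" and V :: "'v set" where
  Var: "v \<in> V \<Longrightarrow> Var v \<in> terms \<Sigma> V"
| Op: "f \<in> symbols \<Sigma> \<Longrightarrow> (\<And>k. k \<in> arity \<Sigma> f \<Longrightarrow> ts k \<in> terms \<Sigma> V) \<Longrightarrow>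
    ts \<in> extensional (arity \<Sigma> f) \<Longrightarrow> Op f ts \<in> terms \<Sigma> V"

primrec eval ::
    "('f, 'i) signature \<Rightarrow> ('f, 'i, 'a) algebra \<Rightarrow> ('v \<Rightarrow> 'a) \<Rightarrow> ('f, 'i, 'v) tm \<Rightarrow> 'a" where
  "eval \<Sigma> A v (Var x) = v x"
| "eval \<Sigma> A v (Op f ts) = oper A f (\<lambda>k \<in> arity \<Sigma> f. eval \<Sigma> A v (ts k))"

text \<open>
  A term is determined by the function assigning to each path from the root the label found at its
  end; this bounds the number of terms without a transfinite construction.
\<close>

primrec labels :: "('f, 'i) signature \<Rightarrow> ('f, 'i, 'v) tm \<Rightarrow> 'i list \<Rightarrow> ('v + 'f) option" where
  "labels \<Sigma> (Var x) = (\<lambda>p. if p = [] then Some (Inl x) else None)"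
| "labels \<Sigma> (Op f ts) = (\<lambda>p. case p of
     [] \<Rightarrow> Some (Inr f)
   | k # q \<Rightarrow> if k \<in> arity \<Sigma> f then labels \<Sigma> (ts k) q else None)"

lemma terms_OpI:
  "f \<in> symbols \<Sigma> \<Longrightarrow> ts \<in> arity \<Sigma> f \<rightarrow>\<^sub>E terms \<Sigma> V \<Longrightarrow> Op f ts \<in> terms \<Sigma> V"
  by (rule terms.Op) (auto dest: PiE_mem simp: PiE_def)

lemma labels_eq_imp_eq:
  assumes "s \<in> terms \<Sigma> V" "t \<in> terms \<Sigma> V"
    and "\<And>p. p \<in> lists (\<Union>f\<in>symbols \<Sigma>. arity \<Sigma> f) \<Longrightarrow> labels \<Sigma> s p = labels \<Sigma> t p"
  shows "s = t"
  using assms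
proof (induction s arbitrary: t rule: terms.induct)
  case (Var v)
  then show ?case
    using Var.prems(2)[of "[]"] by (cases t) auto
next
  case (Op f ts)
  then obtain us where t: "t = Op f us" and us: "\<And>k. k \<in> arity \<Sigma> f \<Longrightarrow> us k \<in> terms \<Sigma> V"
      "us \<in> extensional (arity \<Sigma> f)"
    using Op.prems(2)[of "[]"] by (auto elim: terms.cases)
  have "ts k = us k" if k: "k \<in> arity \<Sigma> f" for k
  proof (rule Op.IH[OF k us(1)[OF k]])
    fix p assume "p \<in> lists (\<Union>f\<in>symbols \<Sigma>. arity \<Sigma> f)"
    then show "labels \<Sigma> (ts k) p = labels \<Sigma> (us k) p"
      using Op.prems(2)[of "k # p"] Op.hyps(1) k t by auto
  qed
  then show ?case
    using t us(2) Op.hyps by (auto intro: extensionalityI)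
qed

lemma labels_mem:
  assumes "t \<in> terms \<Sigma> V"
  shows "labels \<Sigma> t p \<in> insert None (Some ` (Inl ` V \<union> Inr ` symbols \<Sigma>))"
  using assms by (induction arbitrary: p) (auto split: list.split)

lemma eval_closed:
  assumes A: "algebra \<Sigma> A" and v: "v \<in> V \<rightarrow> carrier A" and "t \<in> terms \<Sigma> V"
  shows "eval \<Sigma> A v t \<in> carrier A"
  using assms(3) by induction (use v in \<open>auto intro!: algebra_closed[OF A]\<close>)

lemma hom_eval:
  assumes A: "algebra \<Sigma> A" and v: "v \<in> V \<rightarrow> carrier A"
    and h: "h \<in> hom \<Sigma> A B" and w: "\<And>x. x \<in> V \<Longrightarrow> h (v x) = w x" and "t \<in> terms \<Sigma> V"
  shows "h (eval \<Sigma> A v t) = eval \<Sigma> B w t"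
  using assms(5)
proof induction
  case (Op f ts)
  have "(\<lambda>k \<in> arity \<Sigma> f. eval \<Sigma> A v (ts k)) \<in> arity \<Sigma> f \<rightarrow>\<^sub>E carrier A"
    using Op.hyps eval_closed[OF A v] by auto
  then show ?case
    using Op by (simp add: hom_oper[OF h] cong: restrict_cong)
qed (simp add: w)

text \<open>Each element of \<open>C\<close> is the value of a term and is sent to the value of the
  same term in \<open>D\<close>; \<open>eq\<close> makes this independent of the term.\<close>

lemma generated_hom:
  assumes C: "algebra \<Sigma> C" and w: "w \<in> V \<rightarrow> carrier C"
    and gen: "carrier C = eval \<Sigma> C w ` terms \<Sigma> V"
    and D: "algebra \<Sigma> D" and v: "v \<in> V \<rightarrow> carrier D"
    and eq: "\<And>s t. s \<in> terms \<Sigma> V \<Longrightarrow> t \<in> terms \<Sigma> V \<Longrightarrow> eval \<Sigma> C w s = eval \<Sigma> C w t \<Longrightarrow>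
      eval \<Sigma> D v s = eval \<Sigma> D v t"
  obtains h where "h \<in> hom \<Sigma> C D" "\<And>t. t \<in> terms \<Sigma> V \<Longrightarrow> h (eval \<Sigma> C w t) = eval \<Sigma> D v t"
proof
  define r where "r c = (SOME t. t \<in> terms \<Sigma> V \<and> eval \<Sigma> C w t = c)" for c
  have r: "r c \<in> terms \<Sigma> V" "eval \<Sigma> C w (r c) = c" if "c \<in> carrier C" for c
    using someI_ex[of "\<lambda>t. t \<in> terms \<Sigma> V \<and> eval \<Sigma> C w t = c"] that gen by (auto simp: r_def)
  let ?h = "\<lambda>c \<in> carrier C. eval \<Sigma> D v (r c)"
  show h: "?h (eval \<Sigma> C w t) = eval \<Sigma> D v t" if t: "t \<in> terms \<Sigma> V" for t
    using eq[OF _ t] r eval_closed[OF C w t] by simp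
  show "?h \<in> hom \<Sigma> C D"
  proof (rule homI[OF _ _ C])
    fix f x assume f: "f \<in> symbols \<Sigma>" and x: "x \<in> arity \<Sigma> f \<rightarrow>\<^sub>E carrier C"
    \<comment> \<open>\<open>?t\<close> and the term chosen for \<open>oper C f x\<close> may
      differ, but they have the same value in \<open>C\<close>, so \<open>eq\<close> identifies
      their values in \<open>D\<close>.\<close>
    let ?t = "Op f (\<lambda>k \<in> arity \<Sigma> f. r (x k))"
    have t: "?t \<in> terms \<Sigma> V"
      using f r x by (intro terms_OpI) (auto dest: PiE_mem)
    have "(\<lambda>k \<in> arity \<Sigma> f. eval \<Sigma> C w (r (x k))) = x"
      using r x by (intro PiE_ext[of _ "arity \<Sigma> f" "\<lambda>_. carrier C"]) (auto dest: PiE_mem)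
    then have "eval \<Sigma> C w ?t = oper C f x"
      by (simp cong: restrict_cong)
    then have "eval \<Sigma> D v (r (oper C f x)) = eval \<Sigma> D v ?t"
      using algebra_closed[OF C f x] r by (intro eq t) auto
    also have "\<dots> = oper D f (\<lambda>k \<in> arity \<Sigma> f. eval \<Sigma> D v (r (x k)))"
      by (simp cong: restrict_cong)
    finally show "eval \<Sigma> D v (r (oper C f x)) = \<dots>" .
  qed (auto intro!: r eval_closed[OF D v])
qed

text \<open>A quotient of the term algebra; \<open>g\<close> serves only to place its elements in \<open>'u\<close>.\<close>

lemma term_quotient:
  fixes g :: "('f, 'i, 'v) tm \<Rightarrow> 'u" and E :: "(('f, 'i, 'u) algebra \<times> ('v \<Rightarrow> 'u)) set"
  assumes g: "inj_on g (terms \<Sigma> V)"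
  obtains C :: "('f, 'i, 'u) algebra" and w
  where "algebra \<Sigma> C" "carrier C \<subseteq> g ` terms \<Sigma> V" "w \<in> V \<rightarrow> carrier C"
    "carrier C = eval \<Sigma> C w ` terms \<Sigma> V"
    "\<And>s t. s \<in> terms \<Sigma> V \<Longrightarrow> t \<in> terms \<Sigma> V \<Longrightarrow>
      eval \<Sigma> C w s = eval \<Sigma> C w t \<longleftrightarrow> (\<forall>(D, v) \<in> E. eval \<Sigma> D v s = eval \<Sigma> D v t)"
proof -
  let ?T = "terms \<Sigma> V"
  define R where "R s t \<longleftrightarrow> (\<forall>(D, v) \<in> E. eval \<Sigma> D v s = eval \<Sigma> D v t)" for s t
  have R: "R t t" "R s t \<Longrightarrow> R t s" "R s t \<Longrightarrow> R t u \<Longrightarrow> R s u" for s t u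
    by (simp_all add: R_def split_beta)
  \<comment> \<open>Hilbert choice over the class of \<open>t\<close> gives equivalent terms the
    same representative, since they define the same predicate. The code of the representative stands
    for the class.\<close>
  define r where "r t = (SOME s. s \<in> ?T \<and> R s t)" for t
  have r: "r t \<in> ?T" "R (r t) t" if "t \<in> ?T" for t
    using someI[of "\<lambda>s. s \<in> ?T \<and> R s t" t] that R(1) by (simp_all add: r_def)
  have r_eq: "r s = r t \<longleftrightarrow> R s t" if "s \<in> ?T" "t \<in> ?T" for s t
  proof
    assume "r s = r t"
    then have "R (r s) t"
      using r(2)[OF that(2)] by simp
    then show "R s t"
      using R(2)[OF r(2)[OF that(1)]] R(3) by blast
  next
    assume "R s t"
    then have "R u s \<longleftrightarrow> R u t" for u
      using R by blast
    then show "r s = r t"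
      by (simp add: r_def)
  qed
  define c where "c t = g (r t)" for t
  define k where "k = inv_into ?T g"
  have c_eq: "c s = c t \<longleftrightarrow> R s t" if "s \<in> ?T" "t \<in> ?T" for s t
    using that r_eq r g unfolding c_def by (metis inj_onD)
  have k: "k a \<in> ?T" "c (k a) = a" if a: "a \<in> c ` ?T" for a
  proof -
    obtain t where t: "t \<in> ?T" "a = c t"
      using a by blast
    then have "k a = r t"
      using g r by (simp add: c_def k_def)
    moreover have "c (r t) = c t"
      using t r by (simp add: c_eq)
    ultimately show "k a \<in> ?T" "c (k a) = a"
      using t r by simp_all
  qed
  define C where "C = \<lparr>carrier = c ` ?T,
    oper = (\<lambda>f \<in> symbols \<Sigma>. \<lambda>x \<in> arity \<Sigma> f \<rightarrow>\<^sub>E c ` ?T. c (Op f (\<lambda>j \<in> arity \<Sigma> f. k (x j))))\<rparr>"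
  have alg: "algebra \<Sigma> C"
  proof -
    have "Op f (\<lambda>j \<in> arity \<Sigma> f. k (x j)) \<in> ?T"
      if "f \<in> symbols \<Sigma>" and x: "x \<in> arity \<Sigma> f \<rightarrow>\<^sub>E c ` ?T" for f x
      by (rule terms_OpI[OF that(1)]) (use k(1) PiE_mem[OF x] in auto)
    then show ?thesis
      by (auto simp: algebra_def C_def)
  qed
  have eval: "eval \<Sigma> C (\<lambda>x. c (Var x)) t = c t" if "t \<in> ?T" for t
    using that
  proof induction
    case (Op f ts)
    let ?us = "\<lambda>j \<in> arity \<Sigma> f. k (c (ts j))"
    have "(\<lambda>j \<in> arity \<Sigma> f. c (ts j)) \<in> arity \<Sigma> f \<rightarrow>\<^sub>E c ` ?T"
      using Op.hyps by auto
    then have "eval \<Sigma> C (\<lambda>x. c (Var x)) (Op f ts) = c (Op f ?us)"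
      using Op by (simp add: C_def cong: restrict_cong)
    also have "\<dots> = c (Op f ts)"
    proof (subst c_eq)
      show "Op f ?us \<in> ?T"
        using Op.hyps k by (intro terms_OpI) auto
      show "Op f ts \<in> ?T"
        using Op.hyps by (intro terms.Op)
      \<comment> \<open>\<open>R\<close> is a congruence: replacing each child by the representative
        of its class changes no value under any pair in \<open>E\<close>.\<close>
      have "R (k (c (ts j))) (ts j)" if "j \<in> arity \<Sigma> f" for j
        using that Op.hyps k c_eq by blast
      then have "(\<lambda>j \<in> arity \<Sigma> f. eval \<Sigma> D v (?us j)) = (\<lambda>j \<in> arity \<Sigma> f. eval \<Sigma> D v (ts j))"
        if "(D, v) \<in> E" for D v
        using that by (intro restrict_ext) (auto simp: R_def)
      then show "R (Op f ?us) (Op f ts)"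
        by (auto simp: R_def)
    qed
    finally show ?case .
  qed simp
  show thesis
  proof
    show "algebra \<Sigma> C" by (rule alg)
    show "carrier C \<subseteq> g ` ?T"
      using r by (auto simp: C_def c_def)
    show "(\<lambda>x. c (Var x)) \<in> V \<rightarrow> carrier C"
      by (auto simp: C_def intro: terms.Var)
    show "carrier C = eval \<Sigma> C (\<lambda>x. c (Var x)) ` ?T"
      using eval by (simp add: C_def)
    show "eval \<Sigma> C (\<lambda>x. c (Var x)) s = eval \<Sigma> C (\<lambda>x. c (Var x)) t \<longleftrightarrow>
        (\<forall>(D, v) \<in> E. eval \<Sigma> D v s = eval \<Sigma> D v t)" if "s \<in> ?T" "t \<in> ?T" for s t
      using that eval c_eq by (simp add: R_def)
  qed
qed

section \<open>The size of term algebras, and existence of coproducts\<close>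

context inaccessible_universe
begin

lemma small_terms:
  fixes \<Sigma> :: "('f, 'i) signature" and V :: "'v set"
  assumes \<Sigma>: "small_signature TYPE('u) \<Sigma>" and V: "small TYPE('u) V"
  shows "small TYPE('u) (terms \<Sigma> V)"
proof (rule small_inj_on)
  let ?L = "lists (\<Union>f\<in>symbols \<Sigma>. arity \<Sigma> f)"
  let ?M = "insert None (Some ` (Inl ` V \<union> Inr ` symbols \<Sigma>))"
  show "inj_on (\<lambda>t. restrict (labels \<Sigma> t) ?L) (terms \<Sigma> V)"
  proof (rule inj_onI)
    fix s t assume st: "s \<in> terms \<Sigma> V" "t \<in> terms \<Sigma> V"
      and "restrict (labels \<Sigma> s) ?L = restrict (labels \<Sigma> t) ?L"
    then show "s = t"
      by (intro labels_eq_imp_eq[OF st]) (metis restrict_apply')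
  qed
  show "(\<lambda>t. restrict (labels \<Sigma> t) ?L) ` terms \<Sigma> V \<subseteq> ?L \<rightarrow>\<^sub>E ?M"
    using labels_mem by (intro image_subsetI restrict_PiE_iff[THEN iffD2] ballI)
  show "small TYPE('u) (?L \<rightarrow>\<^sub>E ?M)"
    using \<Sigma> V unfolding small_signature_def
    by (intro small_PiE small_insert small_image small_Un small_lists small_UN) auto
qed

text \<open>Terms over the disjoint union of the carriers are identified when they agree under every
  cocone. The cocones need not form a small set, but the quotient is small because the term algebra
  is. To place it in \<open>P\<close>, one cocone is chosen for each pair of terms that is kept
  apart.\<close>

lemma coproduct_exists:
  fixes \<Sigma> :: "('f, 'i) signature" and P :: "('f, 'i, 'u) algebra set"
  assumes \<Sigma>: "small_signature TYPE('u) \<Sigma>" and P: "prevariety \<Sigma> P"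
    and X: "X \<subseteq> P" "small TYPE('u) X"
  obtains C q where "coproduct \<Sigma> P X C q"
proof -
  define V where "V = Sigma X carrier"
  let ?T = "terms \<Sigma> V"
  define cocone where "cocone D h \<longleftrightarrow> D \<in> P \<and> (\<forall>A\<in>X. h A \<in> hom \<Sigma> A D)"
    for D and h :: "('f, 'i, 'u) algebra \<Rightarrow> 'u \<Rightarrow> 'u"
  define E where "E = {(D, \<lambda>(A, a). h A a) |D h. cocone D h}"
  have PA: "P \<subseteq> algebras \<Sigma>"
    using P by (simp add: prevariety_def)
  have alg: "algebra \<Sigma> A" if "A \<in> P" for A
    using subset_algebrasD(1)[OF PA that] .
  have "small TYPE('u) V"
    unfolding V_def using X subset_algebrasD(2)[OF PA] by (intro small_Sigma) auto
  then have T: "small TYPE('u) ?T"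
    by (rule small_terms[OF \<Sigma>])
  then obtain g :: "_ \<Rightarrow> 'u" where g: "inj_on g ?T"
    using small_code by blast
  obtain C :: "('f, 'i, 'u) algebra" and w where C: "algebra \<Sigma> C" and sub: "carrier C \<subseteq> g ` ?T"
    and w: "w \<in> V \<rightarrow> carrier C" and gen: "carrier C = eval \<Sigma> C w ` ?T"
    and eq: "\<And>s t. s \<in> ?T \<Longrightarrow> t \<in> ?T \<Longrightarrow>
      eval \<Sigma> C w s = eval \<Sigma> C w t \<longleftrightarrow> (\<forall>(D, v) \<in> E. eval \<Sigma> D v s = eval \<Sigma> D v t)"
    using term_quotient[OF g, of E] by blast
  have C_algebras: "C \<in> algebras \<Sigma>"
    using C small_subset[OF small_image[OF T] sub] by (simp add: algebras_def)
  have factor: "\<exists>k \<in> hom \<Sigma> C D. \<forall>t\<in>?T. k (eval \<Sigma> C w t) = eval \<Sigma> D (\<lambda>(A, a). h A a) t"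
    if D: "cocone D h" for D h
  proof -
    have "(\<lambda>(A, a). h A a) \<in> V \<rightarrow> carrier D"
      using D hom_closed by (fastforce simp: V_def cocone_def)
    moreover have "eval \<Sigma> D (\<lambda>(A, a). h A a) s = eval \<Sigma> D (\<lambda>(A, a). h A a) t"
      if "s \<in> ?T" "t \<in> ?T" "eval \<Sigma> C w s = eval \<Sigma> C w t" for s t
      using that eq D by (auto simp: E_def)
    ultimately show ?thesis
      using generated_hom[OF C w gen, of D "\<lambda>(A, a). h A a"] alg D by (metis cocone_def)
  qed
  define q where "q A = (\<lambda>a \<in> carrier A. w (A, a))" for A
  have q: "q A \<in> hom \<Sigma> A C" if A: "A \<in> X" for A
    unfolding q_def
  proof (rule homI)
    show A': "algebra \<Sigma> A"
      using A X(1) alg by blast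
    show "w (A, a) \<in> carrier C" if "a \<in> carrier A" for a
      using A that w by (auto simp: V_def)
    fix f x assume f: "f \<in> symbols \<Sigma>" and x: "x \<in> arity \<Sigma> f \<rightarrow>\<^sub>E carrier A"
    \<comment> \<open>That \<open>q A\<close> preserves \<open>f\<close> is an equation between
      \<open>?t\<close> and a variable. Every cocone satisfies it, as its maps are homomorphisms, so
      it holds in the quotient.\<close>
    let ?t = "Op f (\<lambda>k \<in> arity \<Sigma> f. Var (A, x k))"
    have "?t \<in> ?T"
      using A f x by (intro terms_OpI) (auto simp: V_def intro!: terms.Var dest: PiE_mem)
    moreover have "Var (A, oper A f x) \<in> ?T"
      using A algebra_closed[OF A' f x] by (auto simp: V_def intro: terms.Var)
    moreover have "h A (oper A f x) = eval \<Sigma> D (\<lambda>(A, a). h A a) ?t" if "cocone D h" for D h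
      using that A hom_oper[OF _ f x, of "h A" D] by (simp add: cocone_def cong: restrict_cong)
    ultimately have "eval \<Sigma> C w (Var (A, oper A f x)) = eval \<Sigma> C w ?t"
      by (subst eq) (auto simp: E_def simp del: eval.simps(2))
    then show "w (A, oper A f x) = oper C f (\<lambda>k \<in> arity \<Sigma> f. w (A, x k))"
      by (simp cong: restrict_cong)
  qed
  have "C \<in> P"
  proof -
    \<comment> \<open>A small index set in place of all cocones: a pair of terms with different
      values is told apart by some cocone, and the map induced by that cocone separates these
      values.\<close>
    define I where "I = {(s, t) \<in> ?T \<times> ?T. eval \<Sigma> C w s \<noteq> eval \<Sigma> C w t}"
    have "\<exists>D k. D \<in> P \<and> k \<in> hom \<Sigma> C D \<and> k (eval \<Sigma> C w (fst i)) \<noteq> k (eval \<Sigma> C w (snd i))"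
      if "i \<in> I" for i
    proof -
      have i: "fst i \<in> ?T" "snd i \<in> ?T" and ne: "eval \<Sigma> C w (fst i) \<noteq> eval \<Sigma> C w (snd i)"
        using that by (auto simp: I_def)
      obtain D h where D: "cocone D h"
        and "eval \<Sigma> D (\<lambda>(A, a). h A a) (fst i) \<noteq> eval \<Sigma> D (\<lambda>(A, a). h A a) (snd i)"
        using ne eq[OF i] by (auto simp: E_def)
      then show ?thesis
        using factor[OF D] i by (metis cocone_def)
    qed
    then obtain D k where Dk: "\<And>i. i \<in> I \<Longrightarrow> D i \<in> P" "\<And>i. i \<in> I \<Longrightarrow> k i \<in> hom \<Sigma> C (D i)"
      "\<And>i. i \<in> I \<Longrightarrow> k i (eval \<Sigma> C w (fst i)) \<noteq> k i (eval \<Sigma> C w (snd i))"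
      by metis
    have "a = b" if ab: "a \<in> carrier C" "b \<in> carrier C" and "\<forall>i\<in>I. k i a = k i b" for a b
    proof (rule ccontr)
      assume "a \<noteq> b"
      moreover obtain s t where "s \<in> ?T" "t \<in> ?T" "a = eval \<Sigma> C w s" "b = eval \<Sigma> C w t"
        using ab gen by blast
      ultimately show False
        using that(3) Dk(3)[of "(s, t)"] by (auto simp: I_def)
    qed
    then have "separating \<Sigma> I C D k"
      using Dk(2) unfolding separating_def by blast
    moreover have "small TYPE('u) I"
      using small_Times[OF T T] by (rule small_subset) (auto simp: I_def)
    ultimately show "C \<in> P"
      using Dk(1) by (intro prevariety_separating[OF P C_algebras])
  qed
  moreover have "\<exists>!k. k \<in> hom \<Sigma> C D \<and> (\<forall>A\<in>X. \<forall>a\<in>carrier A. k (q A a) = h A a)"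
    if D: "cocone D h" for D h
  proof -
    obtain k where k: "k \<in> hom \<Sigma> C D"
      and k_eval: "\<And>t. t \<in> ?T \<Longrightarrow> k (eval \<Sigma> C w t) = eval \<Sigma> D (\<lambda>(A, a). h A a) t"
      using factor[OF D] by blast
    show ?thesis
    proof (rule ex1I)
      have "k (w (A, a)) = h A a" if "A \<in> X" "a \<in> carrier A" for A a
        using that k_eval[of "Var (A, a)"] by (simp add: V_def terms.Var)
      then show "k \<in> hom \<Sigma> C D \<and> (\<forall>A\<in>X. \<forall>a\<in>carrier A. k (q A a) = h A a)"
        using k by (simp add: q_def)
      \<comment> \<open>Uniqueness: the coprojections give the values of the variables, and these
        generate \<open>C\<close>.\<close>
      fix l assume l: "l \<in> hom \<Sigma> C D \<and> (\<forall>A\<in>X. \<forall>a\<in>carrier A. l (q A a) = h A a)"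
      have "l (eval \<Sigma> C w t) = k (eval \<Sigma> C w t)" if "t \<in> ?T" for t
        unfolding k_eval[OF that]
        by (rule hom_eval[OF C w _ _ that]) (use l in \<open>auto simp: V_def q_def\<close>)
      then show "l = k"
        using l k gen by (intro hom_eqI[of l \<Sigma> C D k]) auto
    qed
  qed
  ultimately have "coproduct \<Sigma> P X C q"
    unfolding coproduct_def using q by (simp add: cocone_def)
  then show thesis
    by (rule that)
qed

text \<open>Given embeddings \<open>h A\<close> into one \<open>B\<close>, the universal property
  factors each as \<open>k\<close> after \<open>q A\<close>; injectivity of the composite forces
  that of \<open>q A\<close>.\<close>

lemma compatible_iff:
  fixes \<Sigma> :: "('f, 'i) signature" and P :: "('f, 'i, 'u) algebra set"
  assumes \<Sigma>: "small_signature TYPE('u) \<Sigma>" and P: "prevariety \<Sigma> P"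
    and X: "X \<subseteq> P" "small TYPE('u) X"
  shows "compatible \<Sigma> P X \<longleftrightarrow> (\<exists>B\<in>P. \<forall>A\<in>X. embeddable \<Sigma> A B)"
proof
  assume "compatible \<Sigma> P X"
  then show "\<exists>B\<in>P. \<forall>A\<in>X. embeddable \<Sigma> A B"
    unfolding compatible_def coproduct_def embeddable_def by (elim exE conjE) (rule bexI, blast+)
next
  assume "\<exists>B\<in>P. \<forall>A\<in>X. embeddable \<Sigma> A B"
  then obtain B h where B: "B \<in> P" and h: "\<And>A. A \<in> X \<Longrightarrow> h A \<in> hom \<Sigma> A B"
    "\<And>A. A \<in> X \<Longrightarrow> inj_on (h A) (carrier A)"
    unfolding embeddable_def by metis
  obtain C q where Cq: "coproduct \<Sigma> P X C q"
    using coproduct_exists[OF assms] .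
  have "\<exists>k. \<forall>A\<in>X. \<forall>a\<in>carrier A. k (q A a) = h A a"
    using Cq B h(1) unfolding coproduct_def by metis
  then obtain k where "\<And>A a. A \<in> X \<Longrightarrow> a \<in> carrier A \<Longrightarrow> k (q A a) = h A a"
    by blast
  then have "inj_on (q A) (carrier A)" if "A \<in> X" for A
    using h(2)[OF that] that by (metis inj_on_def)
  then show "compatible \<Sigma> P X"
    using Cq unfolding compatible_def by blast
qed

end


subsection \<open>Ultraproducts\<close>

lemma equiv_eventual_equality: "equiv (\<Pi>\<^sub>E i \<in> I. carrier (B i)) (eventual_equality I F B)"
proof (rule equivI)
  show "trans (eventual_equality I F B)"
    by (rule transI) (auto simp: eventual_equality_def elim: eventually_elim2)
  show "sym (eventual_equality I F B)"
    by (rule symI) (auto simp: eventual_equality_def elim: eventually_mono)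
qed (auto simp: eventual_equality_def refl_on_def)

lemma eventual_equality_class_eq:
  assumes "x \<in> (\<Pi>\<^sub>E i \<in> I. carrier (B i))" "y \<in> (\<Pi>\<^sub>E i \<in> I. carrier (B i))"
  shows "eventual_equality I F B `` {x} = eventual_equality I F B `` {y} \<longleftrightarrow> (\<forall>\<^sub>F i in F. x i = y i)"
  using eq_equiv_class_iff[OF equiv_eventual_equality assms] assms by (simp add: eventual_equality_def)

lemma carrier_ultraproduct:
  "carrier (ultraproduct \<Sigma> I F B) = (\<Pi>\<^sub>E i \<in> I. carrier (B i)) // eventual_equality I F B"
  by (simp add: ultraproduct_def Let_def)

lemma oper_ultraproduct:
  "f \<in> symbols \<Sigma> \<Longrightarrow> X \<in> arity \<Sigma> f \<rightarrow>\<^sub>E carrier (ultraproduct \<Sigma> I F B) \<Longrightarrow>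
    oper (ultraproduct \<Sigma> I F B) f X =
      eventual_equality I F B `` {oper (product \<Sigma> I B) f (\<lambda>k \<in> arity \<Sigma> f. SOME x. x \<in> X k)}"
  by (simp add: ultraproduct_def Let_def)

lemma ultraproduct_representative:
  assumes "c \<in> carrier (ultraproduct \<Sigma> I F B)"
  shows "(SOME x. x \<in> c) \<in> (\<Pi>\<^sub>E i \<in> I. carrier (B i))"
    and "c = eventual_equality I F B `` {SOME x. x \<in> c}"
proof -
  let ?R = "eventual_equality I F B"
  obtain y where y: "y \<in> (\<Pi>\<^sub>E i \<in> I. carrier (B i))" "c = ?R `` {y}"
    using assms unfolding carrier_ultraproduct by (rule quotientE)
  then have "y \<in> c"
    using equiv_class_self[OF equiv_eventual_equality y(1), of F] by simp
  then have "(SOME x. x \<in> c) \<in> c"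
    by (rule someI[of "\<lambda>x. x \<in> c"])
  then have "(y, SOME x. x \<in> c) \<in> ?R"
    using y(2) by simp
  moreover have "?R \<subseteq> (\<Pi>\<^sub>E i \<in> I. carrier (B i)) \<times> (\<Pi>\<^sub>E i \<in> I. carrier (B i))"
    by (auto simp: eventual_equality_def)
  ultimately show "(SOME x. x \<in> c) \<in> (\<Pi>\<^sub>E i \<in> I. carrier (B i))"
    by blast
  show "c = ?R `` {SOME x. x \<in> c}"
    using equiv_class_eq[OF equiv_eventual_equality \<open>(y, SOME x. x \<in> c) \<in> ?R\<close>] y(2) by (rule trans[rotated])
qed

lemma representatives_mem:
  "X \<in> J \<rightarrow>\<^sub>E carrier (ultraproduct \<Sigma> I F B) \<Longrightarrow>
    (\<lambda>k \<in> J. SOME x. x \<in> X k) \<in> J \<rightarrow>\<^sub>E carrier (product \<Sigma> I B)"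
  by (erule restrict_comp_PiE) (simp add: ultraproduct_representative(1))

lemma algebra_ultraproduct:
  assumes "\<And>i. i \<in> I \<Longrightarrow> algebra \<Sigma> (B i)"
  shows "algebra \<Sigma> (ultraproduct \<Sigma> I F B)"
proof -
  have "oper (ultraproduct \<Sigma> I F B) f X \<in> carrier (ultraproduct \<Sigma> I F B)"
    if f: "f \<in> symbols \<Sigma>" and X: "X \<in> arity \<Sigma> f \<rightarrow>\<^sub>E carrier (ultraproduct \<Sigma> I F B)" for f X
    using algebra_closed[OF algebra_product[OF assms] f representatives_mem[OF X]]
    unfolding oper_ultraproduct[OF f X] carrier_ultraproduct by (simp add: quotientI)
  then show ?thesis
    by (auto simp: algebra_def ultraproduct_def Let_def)
qed

text \<open>
  A map into the product inducing an embedding into the ultraproduct. Working with representatives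
  allows families of maps which are homomorphisms for almost all indices only.
\<close>

definition almost_embedding ::
    "('f, 'i) signature \<Rightarrow> 'j set \<Rightarrow> 'j filter \<Rightarrow> ('f, 'i, 'a) algebra
      \<Rightarrow> ('j \<Rightarrow> ('f, 'i, 'b) algebra) \<Rightarrow> ('a \<Rightarrow> 'j \<Rightarrow> 'b) \<Rightarrow> bool" where
  "almost_embedding \<Sigma> I F A B e \<longleftrightarrow>
     (\<forall>a\<in>carrier A. \<forall>i\<in>I. e a i \<in> carrier (B i)) \<and>
     (\<forall>f\<in>symbols \<Sigma>. \<forall>x \<in> arity \<Sigma> f \<rightarrow>\<^sub>E carrier A.
        \<forall>\<^sub>F i in F. e (oper A f x) i = oper (B i) f (\<lambda>k \<in> arity \<Sigma> f. e (x k) i)) \<and>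
     (\<forall>a\<in>carrier A. \<forall>b\<in>carrier A. (\<forall>\<^sub>F i in F. e a i = e b i) \<longrightarrow> a = b)"

text \<open>The operations of the ultraproduct use chosen representatives, each equal to
  \<open>e (x k)\<close> at almost all indices. Finite arity makes these equalities hold
  simultaneously at almost all indices, whence the operations agree as classes.\<close>

lemma embeddable_ultraproduct:
  assumes fin: "finitary \<Sigma>" and F: "ultrafilter_on I F" and A: "algebra \<Sigma> A"
    and B: "\<And>i. i \<in> I \<Longrightarrow> algebra \<Sigma> (B i)"
    and e: "almost_embedding \<Sigma> I F A B e"
  shows "embeddable \<Sigma> A (ultraproduct \<Sigma> I F B)"
  unfolding embeddable_def
proof
  let ?R = "eventual_equality I F B" and ?U = "ultraproduct \<Sigma> I F B" and ?P = "product \<Sigma> I B"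
  let ?e = "\<lambda>a. restrict (e a) I"
  let ?h = "\<lambda>a. ?R `` {?e a}"
  note in_I = ultrafilter_on_in[OF F]
  have e_mem: "?e a \<in> (\<Pi>\<^sub>E i \<in> I. carrier (B i))" if "a \<in> carrier A" for a
    using e that by (simp add: almost_embedding_def)
  show "restrict ?h (carrier A) \<in> hom \<Sigma> A ?U"
  proof (rule homI[OF _ _ A])
    show h_mem: "?h a \<in> carrier ?U" if "a \<in> carrier A" for a
      using e_mem[OF that] by (simp add: carrier_ultraproduct quotientI)
    fix f x assume f: "f \<in> symbols \<Sigma>" and x: "x \<in> arity \<Sigma> f \<rightarrow>\<^sub>E carrier A"
    let ?X = "\<lambda>k \<in> arity \<Sigma> f. ?h (x k)"
    let ?y = "\<lambda>k \<in> arity \<Sigma> f. SOME y. y \<in> ?X k"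
    have X: "?X \<in> arity \<Sigma> f \<rightarrow>\<^sub>E carrier ?U"
      using x h_mem by (rule restrict_comp_PiE)
    have y: "?y \<in> arity \<Sigma> f \<rightarrow>\<^sub>E carrier ?P"
      using representatives_mem[OF X] .
    have "\<forall>\<^sub>F i in F. ?e (x k) i = ?y k i" if k: "k \<in> arity \<Sigma> f" for k
    proof -
      have "?h (x k) = ?X k"
        using k by simp
      also have "\<dots> = ?R `` {SOME y. y \<in> ?X k}"
        by (rule ultraproduct_representative(2)[OF PiE_mem[OF X k]])
      also have "\<dots> = ?R `` {?y k}"
        using k by (simp only: restrict_apply')
      finally show ?thesis
        using e_mem[OF PiE_mem[OF x k]] PiE_mem[OF y k]
        by (subst (asm) eventual_equality_class_eq) simp_all
    qed
    then have "\<forall>\<^sub>F i in F. \<forall>k\<in>arity \<Sigma> f. ?e (x k) i = ?y k i"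
      using fin f by (simp add: finitary_def eventually_ball_finite)
    moreover have "\<forall>\<^sub>F i in F. e (oper A f x) i = oper (B i) f (\<lambda>k \<in> arity \<Sigma> f. e (x k) i)"
      using e f x by (simp add: almost_embedding_def)
    ultimately have "\<forall>\<^sub>F i in F. ?e (oper A f x) i = oper ?P f ?y i"
      using in_I
    proof eventually_elim
      case (elim i)
      have "(\<lambda>k \<in> arity \<Sigma> f. e (x k) i) = (\<lambda>k \<in> arity \<Sigma> f. ?y k i)"
        using elim by (intro restrict_ext) simp
      then show ?case
        using elim unfolding oper_product[OF f y] by simp
    qed
    then show "?h (oper A f x) = oper ?U f ?X"
      unfolding oper_ultraproduct[OF f X]
      using e_mem[OF algebra_closed[OF A f x]] algebra_closed[OF algebra_product[OF B] f y]
      by (subst eventual_equality_class_eq) simp_all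
  qed
  show "inj_on (restrict ?h (carrier A)) (carrier A)"
  proof (rule inj_onI)
    fix a b assume ab: "a \<in> carrier A" "b \<in> carrier A"
      and "restrict ?h (carrier A) a = restrict ?h (carrier A) b"
    then have "\<forall>\<^sub>F i in F. ?e a i = ?e b i"
      using e_mem by (simp add: eventual_equality_class_eq)
    then have "\<forall>\<^sub>F i in F. e a i = e b i"
      using in_I by eventually_elim simp
    then show "a = b"
      using e ab by (simp add: almost_embedding_def)
  qed
qed

lemma Ultraprod_almost_embedding:
  fixes A :: "('f, 'i, 'u) algebra"
  assumes "A \<in> Ultraprod \<Sigma> X" "X \<subseteq> algebras \<Sigma>"
  obtains I :: "'u set" and F B e
  where "small TYPE('u) I" "ultrafilter_on I F" "\<And>i. i \<in> I \<Longrightarrow> B i \<in> X"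
    "almost_embedding \<Sigma> I F A B e"
proof -
  obtain I :: "'u set" and F B where I: "small TYPE('u) I" "ultrafilter_on I F"
    "\<And>i. i \<in> I \<Longrightarrow> B i \<in> X"
    and iso: "isomorphic \<Sigma> A (ultraproduct \<Sigma> I F B)" and A: "A \<in> algebras \<Sigma>"
    using assms(1) by (auto simp: Ultraprod_def)
  let ?R = "eventual_equality I F B" and ?U = "ultraproduct \<Sigma> I F B" and ?P = "product \<Sigma> I B"
  obtain h where h: "h \<in> hom \<Sigma> A ?U" "inj_on h (carrier A)"
    using iso by (auto simp: isomorphic_def bij_betw_def)
  have B: "algebra \<Sigma> (B i)" if "i \<in> I" for i
    using subset_algebrasD(1)[OF assms(2) I(3)[OF that]] .
  \<comment> \<open>The same choice as in the operations of \<open>ultraproduct\<close>, so that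
    \<open>?y k\<close> below is \<open>e (x k)\<close> itself and not merely almost everywhere
    equal to it.\<close>
  define e where "e a = (SOME x. x \<in> h a)" for a
  have e: "e a \<in> (\<Pi>\<^sub>E i \<in> I. carrier (B i))" "h a = ?R `` {e a}" if "a \<in> carrier A" for a
    unfolding e_def using ultraproduct_representative[OF hom_closed[OF h(1) that]] by simp_all
  have "\<forall>\<^sub>F i in F. e (oper A f x) i = oper (B i) f (\<lambda>k \<in> arity \<Sigma> f. e (x k) i)"
    if f: "f \<in> symbols \<Sigma>" and x: "x \<in> arity \<Sigma> f \<rightarrow>\<^sub>E carrier A" for f x
  proof -
    let ?X = "\<lambda>k \<in> arity \<Sigma> f. h (x k)"
    let ?y = "\<lambda>k \<in> arity \<Sigma> f. SOME y. y \<in> ?X k"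
    have X: "?X \<in> arity \<Sigma> f \<rightarrow>\<^sub>E carrier ?U"
      using x hom_closed[OF h(1)] by (rule restrict_comp_PiE)
    have y: "?y \<in> arity \<Sigma> f \<rightarrow>\<^sub>E carrier ?P"
      using representatives_mem[OF X] .
    have a: "oper A f x \<in> carrier A"
      using A f x by (intro algebra_closed) (simp_all add: algebras_def)
    have "?R `` {e (oper A f x)} = ?R `` {oper ?P f ?y}"
      using hom_oper[OF h(1) f x] e(2)[OF a] by (simp only: oper_ultraproduct[OF f X])
    then have "\<forall>\<^sub>F i in F. e (oper A f x) i = oper ?P f ?y i"
      using e(1)[OF a] algebra_closed[OF algebra_product[OF B] f y]
      by (subst (asm) eventual_equality_class_eq) simp_all
    then show ?thesis
      using ultrafilter_on_in[OF I(2)]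
    proof eventually_elim
      case (elim i)
      have "(\<lambda>k \<in> arity \<Sigma> f. ?y k i) = (\<lambda>k \<in> arity \<Sigma> f. e (x k) i)"
        by (intro restrict_ext) (simp add: e_def)
      then show ?case
        using elim unfolding oper_product[OF f y] by simp
    qed
  qed
  moreover have "a = b"
    if "a \<in> carrier A" "b \<in> carrier A" "\<forall>\<^sub>F i in F. e a i = e b i" for a b
    using that e h(2) eventual_equality_class_eq[of "e a" I B "e b" F] by (simp add: inj_on_def)
  moreover have "e a i \<in> carrier (B i)" if "a \<in> carrier A" "i \<in> I" for a i
    using PiE_mem[OF e(1)] that .
  ultimately have "almost_embedding \<Sigma> I F A B e"
    by (simp add: almost_embedding_def)
  then show thesis
    using that I by blast
qed

context inaccessible_universe
begin

text \<open>The counterpart of \<open>Prod_embeds\<close>: again \<open>D\<close> depends only on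
  the factors and the filter, so it serves several algebras at once. The ultrafilter moves along the
  recoding of the indices.\<close>

lemma Ultraprod_embeds:
  fixes B :: "'j \<Rightarrow> ('f, 'i, 'u) algebra"
  assumes fin: "finitary \<Sigma>" and I: "small TYPE('u) I" and F: "ultrafilter_on I F"
    and B: "\<And>i. i \<in> I \<Longrightarrow> B i \<in> X" and X: "X \<subseteq> algebras \<Sigma>"
  obtains D where "D \<in> Ultraprod \<Sigma> X"
    "\<And>(A :: ('f, 'i, 'u) algebra) e. algebra \<Sigma> A \<Longrightarrow> almost_embedding \<Sigma> I F A B e \<Longrightarrow> embeddable \<Sigma> A D"
proof -
  obtain g :: "'j \<Rightarrow> 'u" where g: "inj_on g I"
    using small_code[OF I] .
  define r where "r = inv_into I g"
  have r: "r (g i) = i" if "i \<in> I" for i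
    using g that by (simp add: r_def)
  let ?D = "ultraproduct \<Sigma> (g ` I) (filtermap g F) (B \<circ> r)"
  have alg: "algebra \<Sigma> ((B \<circ> r) j)" "small TYPE('u) (carrier ((B \<circ> r) j))" if "j \<in> g ` I" for j
    using subset_algebrasD[OF X B] r that by auto
  have algD: "algebra \<Sigma> ?D"
    using alg by (intro algebra_ultraproduct)
  have "small TYPE('u) (carrier ?D)"
    unfolding carrier_ultraproduct quotient_def
    using alg(2) by (intro small_UN small_PiE small_image I) (auto simp: small_finite)
  then obtain D :: "('f, 'i, 'u) algebra"
    where D: "D \<in> algebras \<Sigma>" "isomorphic \<Sigma> D ?D" "isomorphic \<Sigma> ?D D"
    using small_copy[OF algD] by metis
  have "\<forall>j \<in> g ` I. (B \<circ> r) j \<in> X"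
    using B r by simp
  then have "D \<in> Ultraprod \<Sigma> X"
    using D small_image[OF I, of g] ultrafilter_on_filtermap[OF F, of g] unfolding Ultraprod_def by blast
  moreover have "embeddable \<Sigma> A D" if A: "algebra \<Sigma> A" and e: "almost_embedding \<Sigma> I F A B e"
    for A :: "('f, 'i, 'u) algebra" and e
  proof -
    have "almost_embedding \<Sigma> (g ` I) (filtermap g F) A (B \<circ> r) (\<lambda>a. e a \<circ> r)"
      unfolding almost_embedding_def eventually_filtermap
    proof (intro conjI ballI impI)
      show "(e a \<circ> r) j \<in> carrier ((B \<circ> r) j)" if "a \<in> carrier A" "j \<in> g ` I" for a j
        using e that r by (auto simp: almost_embedding_def)
      fix f x assume "f \<in> symbols \<Sigma>" "x \<in> arity \<Sigma> f \<rightarrow>\<^sub>E carrier A"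
      then have "\<forall>\<^sub>F i in F. e (oper A f x) i = oper (B i) f (\<lambda>k \<in> arity \<Sigma> f. e (x k) i)"
        using e by (simp add: almost_embedding_def)
      then show "\<forall>\<^sub>F i in F. (e (oper A f x) \<circ> r) (g i) =
          oper ((B \<circ> r) (g i)) f (\<lambda>k \<in> arity \<Sigma> f. (e (x k) \<circ> r) (g i))"
        using ultrafilter_on_in[OF F] by eventually_elim (simp add: r)
    next
      fix a b assume ab: "a \<in> carrier A" "b \<in> carrier A"
        and "\<forall>\<^sub>F i in F. (e a \<circ> r) (g i) = (e b \<circ> r) (g i)"
      then have "\<forall>\<^sub>F i in F. e a i = e b i"
        using ultrafilter_on_in[OF F] by (auto elim: eventually_elim2 simp: r)
      then show "a = b"
        using e ab by (simp add: almost_embedding_def)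
    qed
    then have "embeddable \<Sigma> A ?D"
      using alg by (intro embeddable_ultraproduct[OF fin ultrafilter_on_filtermap[OF F] A])
    then show ?thesis
      using embeddable_trans[OF A] isomorphic_imp_embeddable[OF D(3)] by blast
  qed
  ultimately show thesis
    using that by blast
qed

end


subsection \<open>Joint embeddability\<close>

text \<open>For small subsets of a prevariety this is compatibility, by
  \<open>compatible_iff\<close>, but it can be verified without a coproduct.\<close>

definition jointly_embeddable ::
    "('f, 'i) signature \<Rightarrow> ('f, 'i, 'u) algebra set \<Rightarrow> ('f, 'i, 'u) algebra set \<Rightarrow> bool" where
  "jointly_embeddable \<Sigma> P X \<longleftrightarrow> (\<exists>D\<in>P. \<forall>A\<in>X. embeddable \<Sigma> A D)"

lemma prevariety_algebras: "prevariety \<Sigma> P \<Longrightarrow> P \<subseteq> algebras \<Sigma>"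
  by (simp add: prevariety_def)

lemma quasivariety_generated_least:
  "quasivariety \<Sigma> Q \<Longrightarrow> X \<subseteq> Q \<Longrightarrow> quasivariety_generated \<Sigma> X \<subseteq> Q"
  by (auto simp: quasivariety_generated_def)

text \<open>On a set of indices outside the filter, \<open>k i\<close> has only to take values in
  the right carrier. This leaves room for default values and for maps that collapse.\<close>

lemma almost_embedding_eventually:
  assumes "F \<noteq> bot" and "\<forall>\<^sub>F i in F. k i \<in> hom \<Sigma> A (D i)"
    and inj: "\<forall>\<^sub>F i in F. inj_on (k i) (carrier A)"
    and "\<And>a i. a \<in> carrier A \<Longrightarrow> i \<in> I \<Longrightarrow> k i a \<in> carrier (D i)"
  shows "almost_embedding \<Sigma> I F A D (\<lambda>a i. k i a)"
  unfolding almost_embedding_def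
proof (intro conjI ballI impI)
  fix f x assume f: "f \<in> symbols \<Sigma>" and x: "x \<in> arity \<Sigma> f \<rightarrow>\<^sub>E carrier A"
  show "\<forall>\<^sub>F i in F. k i (oper A f x) = oper (D i) f (\<lambda>j \<in> arity \<Sigma> f. k i (x j))"
    using assms(2) by (rule eventually_mono) (rule hom_oper[OF _ f x])
next
  fix a b assume ab: "a \<in> carrier A" "b \<in> carrier A" and eq: "\<forall>\<^sub>F i in F. k i a = k i b"
  have "\<forall>\<^sub>F i in F. a = b"
    using eq inj by eventually_elim (simp add: ab inj_on_def)
  then show "a = b"
    using assms(1) by simp
qed (rule assms(4))

lemma almost_embedding_compose:
  assumes e: "almost_embedding \<Sigma> I F A B e" and in_I: "\<forall>\<^sub>F i in F. i \<in> I" and A: "algebra \<Sigma> A"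
    and k: "\<And>i. i \<in> I \<Longrightarrow> k i \<in> hom \<Sigma> (B i) (D i)" "\<And>i. i \<in> I \<Longrightarrow> inj_on (k i) (carrier (B i))"
  shows "almost_embedding \<Sigma> I F A D (\<lambda>a i. k i (e a i))"
  unfolding almost_embedding_def
proof (intro conjI ballI impI)
  have e_mem: "e a i \<in> carrier (B i)" if "a \<in> carrier A" "i \<in> I" for a i
    using e that by (simp add: almost_embedding_def)
  then show "k i (e a i) \<in> carrier (D i)" if "a \<in> carrier A" "i \<in> I" for a i
    using that hom_closed[OF k(1)] by blast
  fix f x assume f: "f \<in> symbols \<Sigma>" and x: "x \<in> arity \<Sigma> f \<rightarrow>\<^sub>E carrier A"
  have "\<forall>\<^sub>F i in F. e (oper A f x) i = oper (B i) f (\<lambda>j \<in> arity \<Sigma> f. e (x j) i)"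
    using e f x by (simp add: almost_embedding_def)
  then show "\<forall>\<^sub>F i in F. k i (e (oper A f x) i) = oper (D i) f (\<lambda>j \<in> arity \<Sigma> f. k i (e (x j) i))"
    using in_I
  proof eventually_elim
    case (elim i)
    have "(\<lambda>j \<in> arity \<Sigma> f. e (x j) i) \<in> arity \<Sigma> f \<rightarrow>\<^sub>E carrier (B i)"
      using x e_mem[OF _ elim(2)] by (rule restrict_comp_PiE)
    then show ?case
      using elim hom_oper[OF k(1)[OF elim(2)] f] by (simp cong: restrict_cong)
  qed
next
  fix a b assume ab: "a \<in> carrier A" "b \<in> carrier A" and eq: "\<forall>\<^sub>F i in F. k i (e a i) = k i (e b i)"
  have "\<forall>\<^sub>F i in F. e a i = e b i"
    using eq in_I
  proof eventually_elim
    case (elim i)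
    then show ?case
      using e ab k(2)[OF elim(2)] by (simp add: almost_embedding_def inj_on_def)
  qed
  then show "a = b"
    using e ab by (simp add: almost_embedding_def)
qed

context inaccessible_universe
begin

text \<open>Treats trivial and nontrivial factors uniformly. For trivial \<open>A\<close> one takes
  \<open>D = A\<close> and collapses \<open>B\<close> to a point; \<open>b\<close> is injective as
  soon as \<open>A\<close> is nontrivial.\<close>

lemma extension_of_member:
  fixes A B :: "('f, 'i, 'u) algebra"
  assumes P: "prevariety \<Sigma> P" and A: "A \<in> P" and B: "B \<in> P"
    and "trivial A \<or> jointly_embeddable \<Sigma> P {A, B}"
  shows "\<exists>D e b. D \<in> P \<and> e \<in> hom \<Sigma> A D \<and> inj_on e (carrier A) \<and> b \<in> hom \<Sigma> B D \<and>
    (\<not> trivial A \<longrightarrow> inj_on b (carrier B))"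
proof (cases "trivial A")
  case True
  note alg = subset_algebrasD(1)[OF prevariety_algebras[OF P]]
  obtain a where a: "carrier A = {a}"
    using True by (auto simp: trivial_def)
  have "(\<lambda>_ \<in> carrier B. a) \<in> hom \<Sigma> B A"
    by (rule hom_to_trivial[OF alg[OF B] alg[OF A] a])
  then show ?thesis
    using True A embeddable_refl[OF alg[OF A]] unfolding embeddable_def by blast
next
  case False
  then obtain D where "D \<in> P" "embeddable \<Sigma> A D" "embeddable \<Sigma> B D"
    using assms(4) by (auto simp: jointly_embeddable_def)
  then show ?thesis
    unfolding embeddable_def by blast
qed

text \<open>Extending each factor by \<open>extension_of_member\<close> also gives maps out of
  \<open>B\<close>, some of which collapse. One injective coordinate suffices for a product, almost
  all for an ultraproduct; two distinct elements of \<open>A\<close> guarantee them.\<close>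

lemma quasivariety_jointly_embeddable:
  fixes B :: "('f, 'i, 'u) algebra"
  assumes P: "quasivariety \<Sigma> P" and B: "B \<in> P"
  shows "quasivariety \<Sigma> {A \<in> P. trivial A \<or> jointly_embeddable \<Sigma> P {A, B}}" (is "quasivariety \<Sigma> ?Q")
proof -
  have fin: "finitary \<Sigma>" and pre: "prevariety \<Sigma> P" and ultra: "Ultraprod \<Sigma> P \<subseteq> P"
    using P by (auto simp: quasivariety_def)
  then have PA: "P \<subseteq> algebras \<Sigma>" and prod: "Prod \<Sigma> P \<subseteq> P"
    by (auto simp: prevariety_def)
  note alg = subset_algebrasD(1)[OF PA]
  have QA: "?Q \<subseteq> algebras \<Sigma>"
    using PA by blast
  have mono: "Prod \<Sigma> ?Q \<subseteq> Prod \<Sigma> P" "Ultraprod \<Sigma> ?Q \<subseteq> Ultraprod \<Sigma> P"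
    by (auto simp: Prod_def Ultraprod_def)
  \<comment> \<open>The empty algebra and \<open>B\<close> both embed in \<open>B\<close>. The
    arguments below may then assume that \<open>A\<close> has two distinct elements.\<close>
  have empty: "jointly_embeddable \<Sigma> P {A, B}" if "A \<in> P" "carrier A = {}" for A
    using that B embeddable_refl[OF alg[OF B]] embeddable_empty[OF alg[OF that(1)] that(2)]
    by (auto simp: jointly_embeddable_def)
  have "Sub \<Sigma> ?Q \<subseteq> ?Q"
  proof
    fix A assume "A \<in> Sub \<Sigma> ?Q"
    then obtain A' where A': "A' \<in> ?Q" and emb: "embeddable \<Sigma> A A'" and A: "A \<in> algebras \<Sigma>"
      unfolding Sub_iff[OF QA] by blast
    have AP: "A \<in> P"
      using prevariety_embeddable[OF pre A _ emb] A' by blast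
    have "jointly_embeddable \<Sigma> P {A, B}" if "\<not> trivial A"
    proof (cases "trivial A'")
      case True
      then show ?thesis
        using empty[OF AP] embeddable_in_trivial[OF emb] that by blast
    next
      case False
      then show ?thesis
        using A' embeddable_trans[OF alg[OF AP] emb] by (auto simp: jointly_embeddable_def)
    qed
    then show "A \<in> ?Q"
      using AP by blast
  qed
  moreover have "Prod \<Sigma> ?Q \<subseteq> ?Q"
  proof
    fix A assume A: "A \<in> Prod \<Sigma> ?Q"
    then have AP: "A \<in> P"
      using mono prod by blast
    obtain I :: "'u set" and C h where I: "small TYPE('u) I" and C: "\<And>i. i \<in> I \<Longrightarrow> C i \<in> ?Q"
      and sep: "separating \<Sigma> I A C h"
      using Prod_separating[OF A QA] by blast
    have "jointly_embeddable \<Sigma> P {A, B}" if nt: "\<not> trivial A" and ne: "carrier A \<noteq> {}"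
    proof -
      have "\<forall>i\<in>I. \<exists>D e b. D \<in> P \<and> e \<in> hom \<Sigma> (C i) D \<and> inj_on e (carrier (C i)) \<and> b \<in> hom \<Sigma> B D \<and>
          (\<not> trivial (C i) \<longrightarrow> inj_on b (carrier B))"
        using extension_of_member[OF pre _ B] C by blast
      then obtain D e b where D: "\<And>i. i \<in> I \<Longrightarrow> D i \<in> P"
        and e: "\<And>i. i \<in> I \<Longrightarrow> e i \<in> hom \<Sigma> (C i) (D i)" "\<And>i. i \<in> I \<Longrightarrow> inj_on (e i) (carrier (C i))"
        and b: "\<And>i. i \<in> I \<Longrightarrow> b i \<in> hom \<Sigma> B (D i)"
          "\<And>i. i \<in> I \<Longrightarrow> \<not> trivial (C i) \<Longrightarrow> inj_on (b i) (carrier B)"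
        by metis
      obtain E where E: "E \<in> Prod \<Sigma> P" and emb: "\<And>(A :: ('f, 'i, 'u) algebra) h.
          algebra \<Sigma> A \<Longrightarrow> separating \<Sigma> I A D h \<Longrightarrow> embeddable \<Sigma> A E"
        using Prod_embeds[where B = D, OF I D PA] by blast
      have h: "h i \<in> hom \<Sigma> A (C i)" if "i \<in> I" for i
        using sep that by (simp add: separating_def)
      have "separating \<Sigma> I A D (\<lambda>i. compose (carrier A) (e i) (h i))"
        unfolding separating_def
      proof (intro conjI ballI impI)
        show "compose (carrier A) (e i) (h i) \<in> hom \<Sigma> A (D i)" if "i \<in> I" for i
          using hom_compose[OF alg[OF AP] h[OF that] e(1)[OF that]] .
        fix x y assume xy: "x \<in> carrier A" "y \<in> carrier A"
          and "\<forall>i\<in>I. compose (carrier A) (e i) (h i) x = compose (carrier A) (e i) (h i) y"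
        then have "h i x = h i y" if "i \<in> I" for i
          using that inj_onD[OF e(2)[OF that]] hom_closed[OF h[OF that]] by (simp add: compose_eq)
        then show "x = y"
          using sep xy by (simp add: separating_def)
      qed
      then have "embeddable \<Sigma> A E"
        by (rule emb[OF alg[OF AP]])
      \<comment> \<open>A coordinate at which two elements of \<open>A\<close> differ has a
        nontrivial factor, so \<open>b i\<close> is injective and by itself separates the points of
        \<open>B\<close>.\<close>
      moreover obtain i where i: "i \<in> I" "\<not> trivial (C i)"
      proof -
        obtain x y where xy: "x \<in> carrier A" "y \<in> carrier A" "x \<noteq> y"
          using not_trivialE[OF nt ne] .
        then have "\<not> (\<forall>i\<in>I. h i x = h i y)"
          using sep unfolding separating_def by blast
        then obtain i where i: "i \<in> I" "h i x \<noteq> h i y"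
          by blast
        moreover have "h i x \<in> carrier (C i)" "h i y \<in> carrier (C i)"
          using hom_closed[OF h[OF i(1)]] xy by blast+
        ultimately have "\<not> trivial (C i)"
          by (auto simp: trivial_def)
        then show thesis
          by (rule that[OF i(1)])
      qed
      have "separating \<Sigma> I B D b"
        unfolding separating_def using b(1) inj_onD[OF b(2)[OF i]] i(1) by blast
      then have "embeddable \<Sigma> B E"
        by (rule emb[OF alg[OF B]])
      ultimately show ?thesis
        using E prod by (auto simp: jointly_embeddable_def)
    qed
    then show "A \<in> ?Q"
      using AP empty by blast
  qed
  moreover have "Ultraprod \<Sigma> ?Q \<subseteq> ?Q"
  proof
    fix A assume A: "A \<in> Ultraprod \<Sigma> ?Q"
    then have AP: "A \<in> P"
      using mono ultra by blast
    obtain I :: "'u set" and F C h where I: "small TYPE('u) I" and F: "ultrafilter_on I F"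
      and C: "\<And>i. i \<in> I \<Longrightarrow> C i \<in> ?Q" and h: "almost_embedding \<Sigma> I F A C h"
      using Ultraprod_almost_embedding[OF A QA] by blast
    note in_I = ultrafilter_on_in[OF F]
    have "jointly_embeddable \<Sigma> P {A, B}" if nt: "\<not> trivial A" and ne: "carrier A \<noteq> {}"
    proof -
      have "\<forall>i\<in>I. \<exists>D e b. D \<in> P \<and> e \<in> hom \<Sigma> (C i) D \<and> inj_on e (carrier (C i)) \<and> b \<in> hom \<Sigma> B D \<and>
          (\<not> trivial (C i) \<longrightarrow> inj_on b (carrier B))"
        using extension_of_member[OF pre _ B] C by blast
      then obtain D e b where D: "\<And>i. i \<in> I \<Longrightarrow> D i \<in> P"
        and e: "\<And>i. i \<in> I \<Longrightarrow> e i \<in> hom \<Sigma> (C i) (D i)" "\<And>i. i \<in> I \<Longrightarrow> inj_on (e i) (carrier (C i))"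
        and b: "\<And>i. i \<in> I \<Longrightarrow> b i \<in> hom \<Sigma> B (D i)"
          "\<And>i. i \<in> I \<Longrightarrow> \<not> trivial (C i) \<Longrightarrow> inj_on (b i) (carrier B)"
        by metis
      obtain E where E: "E \<in> Ultraprod \<Sigma> P" and emb: "\<And>(A :: ('f, 'i, 'u) algebra) h.
          algebra \<Sigma> A \<Longrightarrow> almost_embedding \<Sigma> I F A D h \<Longrightarrow> embeddable \<Sigma> A E"
        using Ultraprod_embeds[where B = D, OF fin I F D PA] by blast
      have "embeddable \<Sigma> A E"
        by (rule emb[OF alg[OF AP] almost_embedding_compose[OF h in_I alg[OF AP] e]])
      moreover have "embeddable \<Sigma> B E"
      proof (rule emb[OF alg[OF B] almost_embedding_eventually])
        show "F \<noteq> bot"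
          using F by (simp add: ultrafilter_on_def)
        show "\<forall>\<^sub>F i in F. b i \<in> hom \<Sigma> B (D i)"
          using in_I by (rule eventually_mono) (rule b(1))
        \<comment> \<open>As \<open>x\<close> and \<open>y\<close> are distinct, their coordinates
          do not agree almost everywhere; for an ultrafilter this means that they differ at almost
          all indices, where the factor is then nontrivial.\<close>
        obtain x y where xy: "x \<in> carrier A" "y \<in> carrier A" "x \<noteq> y"
          using not_trivialE[OF nt ne] .
        then have "\<forall>\<^sub>F i in F. h x i \<noteq> h y i"
          using h ultrafilter_on_not[OF F, of "\<lambda>i. h x i = h y i"] by (auto simp: almost_embedding_def)
        then show "\<forall>\<^sub>F i in F. inj_on (b i) (carrier B)"
          using in_I
        proof eventually_elim
          case (elim i)
          moreover have "h x i \<in> carrier (C i)" "h y i \<in> carrier (C i)"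
            using h xy elim by (auto simp: almost_embedding_def)
          ultimately show ?case
            by (intro b(2)) (auto simp: trivial_def)
        qed
        show "b i a \<in> carrier (D i)" if "a \<in> carrier B" "i \<in> I" for a i
          using hom_closed[OF b(1)[OF that(2)] that(1)] .
      qed
      ultimately show ?thesis
        using E ultra by (auto simp: jointly_embeddable_def)
    qed
    then show "A \<in> ?Q"
      using AP empty by blast
  qed
  ultimately show ?thesis
    using fin QA by (simp add: quasivariety_def prevariety_def)
qed

text \<open>
  The previous lemma is applied first to the members of \<open>K\<close>, and then, by symmetry of joint
  embeddability, to an arbitrary nontrivial \<open>A\<close>. This avoids describing \<open>quasivariety_generated\<close>
  by ultraproducts.
\<close>

lemma generated_by_directed_imp_pairs:
  fixes P :: "('f, 'i, 'u) algebra set"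
  assumes P: "quasivariety \<Sigma> P" and K: "K \<subseteq> P" "absolutely_directed TYPE('u) (embeddable \<Sigma>) K"
    and gen: "P = quasivariety_generated \<Sigma> K"
    and AB: "A \<in> P" "B \<in> P" "\<not> trivial A"
  shows "jointly_embeddable \<Sigma> P {A, B} \<or> trivial B"
proof -
  let ?Q = "\<lambda>B. {A \<in> P. trivial A \<or> jointly_embeddable \<Sigma> P {A, B}}"
  have Q: "P \<subseteq> ?Q B" if "B \<in> P" "K \<subseteq> ?Q B" for B
    using quasivariety_generated_least[OF quasivariety_jointly_embeddable[OF P that(1)] that(2)]
    by (simp only: gen[symmetric])
  have "K \<subseteq> ?Q B" if B: "B \<in> K" for B
  proof
    fix A assume A: "A \<in> K"
    then have "{A, B} \<subseteq> K \<and> small TYPE('u) {A, B}"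
      using B by (simp add: small_finite)
    then obtain D where "D \<in> K" "\<forall>C\<in>{A, B}. embeddable \<Sigma> C D"
      using K(2)[unfolded absolutely_directed_def, rule_format, of "{A, B}"] by blast
    then show "A \<in> ?Q B"
      using A K(1) by (auto simp: jointly_embeddable_def)
  qed
  then have "A \<in> ?Q C" if "C \<in> K" for C
    using Q[of C] that K(1) AB(1) by blast
  then have "K \<subseteq> ?Q A"
    using AB(3) K(1) by (auto simp: insert_commute)
  then have "B \<in> ?Q A"
    using Q[OF AB(1)] AB(2) by blast
  then show ?thesis
    by (auto simp: insert_commute)
qed

text \<open>Nonemptiness of \<open>D\<close> is carried along because the later ultraproduct takes a
  default element from each \<open>D\<close>. The price is that \<open>D\<close> may be trivial,
  starting with the base case, and \<open>pairs\<close> says nothing about a trivial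
  \<open>D\<close>.\<close>

lemma pairs_imp_finite:
  fixes P :: "('f, 'i, 'u) algebra set"
  assumes P: "prevariety \<Sigma> P"
    and pairs: "\<And>A B. A \<in> P \<Longrightarrow> B \<in> P \<Longrightarrow> \<not> trivial A \<Longrightarrow> \<not> trivial B \<Longrightarrow> jointly_embeddable \<Sigma> P {A, B}"
    and "finite X" "X \<subseteq> P" "\<And>A. A \<in> X \<Longrightarrow> \<not> trivial A"
  shows "\<exists>D\<in>P. carrier D \<noteq> {} \<and> (\<forall>A\<in>X. embeddable \<Sigma> A D)"
  using assms(3-)
proof (induction X)
  case empty
  obtain T :: "('f, 'i, 'u) algebra" where T: "T \<in> algebras \<Sigma>" "trivial T"
    using ex_trivial .
  then show ?case
    using prevariety_trivial[OF P] by (auto simp: trivial_def)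
next
  case (insert A X)
  note alg = subset_algebrasD(1)[OF prevariety_algebras[OF P]]
  obtain D where D: "D \<in> P" "carrier D \<noteq> {}" "\<forall>C\<in>X. embeddable \<Sigma> C D"
    using insert by auto
  have A: "A \<in> P" "\<not> trivial A"
    using insert.prems by auto
  show ?case
  proof (cases "carrier A = {}")
    case True
    then show ?thesis
      using D embeddable_empty[OF alg[OF A(1)] True, of D] by (intro bexI[of _ D]) auto
  next
    case ne: False
    show ?thesis
    proof (cases "trivial D")
      \<comment> \<open>The earlier algebras are nontrivial and embed in a trivial one, so they are
        all empty; \<open>A\<close> itself contains them.\<close>
      case True
      have "embeddable \<Sigma> C A" if "C \<in> X" for C
      proof -
        have "C \<in> P" "\<not> trivial C"
          using that insert.prems by auto
        then show ?thesis
          using embeddable_empty[OF alg] embeddable_in_trivial[OF _ True] D(3) that by blast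
      qed
      then show ?thesis
        using A ne embeddable_refl[OF alg] by auto
    next
      case False
      then obtain E where E: "E \<in> P" "embeddable \<Sigma> A E" "embeddable \<Sigma> D E"
        using pairs[OF A(1) D(1) A(2)] by (auto simp: jointly_embeddable_def)
      have "embeddable \<Sigma> C E" if "C \<in> X" for C
        using that insert.prems D(3) embeddable_trans[OF alg _ E(3), of C] by auto
      moreover have "carrier E \<noteq> {}"
        using E(2) ne hom_closed unfolding embeddable_def by fastforce
      ultimately show ?thesis
        using E by auto
    qed
  qed
qed

lemma pairs_imp_all:
  fixes P :: "('f, 'i, 'u) algebra set"
  assumes P: "quasivariety \<Sigma> P"
    and pairs: "\<And>A B. A \<in> P \<Longrightarrow> B \<in> P \<Longrightarrow> \<not> trivial A \<Longrightarrow> \<not> trivial B \<Longrightarrow> jointly_embeddable \<Sigma> P {A, B}"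
    and X: "X \<subseteq> P" "small TYPE('u) X" and nt: "\<And>A. A \<in> X \<Longrightarrow> \<not> trivial A"
  shows "jointly_embeddable \<Sigma> P X"
proof -
  have fin: "finitary \<Sigma>" and pre: "prevariety \<Sigma> P" and ultra: "Ultraprod \<Sigma> P \<subseteq> P"
    using P by (auto simp: quasivariety_def)
  note PA = prevariety_algebras[OF pre]
  define I where "I = {S. finite S \<and> S \<subseteq> X}"
  obtain F where F: "ultrafilter_on I F" and mem: "\<And>A. A \<in> X \<Longrightarrow> \<forall>\<^sub>F S in F. A \<in> S"
    using ultrafilter_on_finite_subsets[of X] unfolding I_def by blast
  have I: "small TYPE('u) I"
    using small_Pow[OF X(2)] by (rule small_subset) (auto simp: I_def)
  have "\<exists>D. D \<in> P \<and> carrier D \<noteq> {} \<and> (\<forall>A\<in>S. embeddable \<Sigma> A D)" if "S \<in> I" for S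
  proof -
    have "finite S" "S \<subseteq> P" "\<And>A. A \<in> S \<Longrightarrow> \<not> trivial A"
      using that X(1) nt by (auto simp: I_def)
    then show ?thesis
      using pairs_imp_finite[OF pre pairs, of S] by (simp add: Bex_def)
  qed
  then obtain D where D: "\<And>S. S \<in> I \<Longrightarrow> D S \<in> P" "\<And>S. S \<in> I \<Longrightarrow> carrier (D S) \<noteq> {}"
    "\<And>S A. S \<in> I \<Longrightarrow> A \<in> S \<Longrightarrow> embeddable \<Sigma> A (D S)"
    by metis
  then obtain h where h: "\<And>S A. S \<in> I \<Longrightarrow> A \<in> S \<Longrightarrow> h S A \<in> hom \<Sigma> A (D S)"
    "\<And>S A. S \<in> I \<Longrightarrow> A \<in> S \<Longrightarrow> inj_on (h S A) (carrier A)"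
    unfolding embeddable_def by metis
  \<comment> \<open>A default value for the sets \<open>S\<close> that do not contain
    \<open>A\<close>, for which no map from \<open>A\<close> to \<open>D S\<close> is given.\<close>
  define d where "d S = (SOME x. x \<in> carrier (D S))" for S
  have d: "d S \<in> carrier (D S)" if "S \<in> I" for S
    using D(2)[OF that] by (simp add: d_def some_in_eq)
  obtain E where E: "E \<in> Ultraprod \<Sigma> P" and emb: "\<And>(A :: ('f, 'i, 'u) algebra) h.
      algebra \<Sigma> A \<Longrightarrow> almost_embedding \<Sigma> I F A D h \<Longrightarrow> embeddable \<Sigma> A E"
    using Ultraprod_embeds[where B = D, OF fin I F D(1) PA] by blast
  have "embeddable \<Sigma> A E" if A: "A \<in> X" for A
  proof (rule emb)
    show "algebra \<Sigma> A"
      using A X(1) subset_algebrasD(1)[OF PA] by blast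
    let ?k = "\<lambda>S. if A \<in> S then h S A else (\<lambda>_. d S)"
    show "almost_embedding \<Sigma> I F A D (\<lambda>a S. ?k S a)"
    proof (rule almost_embedding_eventually)
      show "F \<noteq> bot"
        using F by (simp add: ultrafilter_on_def)
      show "\<forall>\<^sub>F S in F. ?k S \<in> hom \<Sigma> A (D S)"
        using mem[OF A] ultrafilter_on_in[OF F] by eventually_elim (simp add: h)
      show "\<forall>\<^sub>F S in F. inj_on (?k S) (carrier A)"
        using mem[OF A] ultrafilter_on_in[OF F] by eventually_elim (simp add: h)
      show "?k S a \<in> carrier (D S)" if "a \<in> carrier A" "S \<in> I" for a S
        using that d hom_closed[OF h(1)] by auto
    qed
  qed
  then show ?thesis
    using E ultra by (auto simp: jointly_embeddable_def)
qed

end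


subsection \<open>Finitely generated algebras and generation\<close>

lemma generated_copy:
  fixes A :: "('f, 'i, 'u) algebra" and g :: "('f, 'i, 'v) tm \<Rightarrow> 'u"
  assumes g: "inj_on g (terms \<Sigma> V)" and A: "algebra \<Sigma> A" and v: "v \<in> V \<rightarrow> carrier A"
  obtains C :: "('f, 'i, 'u) algebra" and h
  where "algebra \<Sigma> C" "carrier C \<subseteq> g ` terms \<Sigma> V" "h \<in> hom \<Sigma> C A" "inj_on h (carrier C)"
    "v ` V \<subseteq> h ` carrier C"
proof -
  obtain C :: "('f, 'i, 'u) algebra" and w where C: "algebra \<Sigma> C" "carrier C \<subseteq> g ` terms \<Sigma> V"
    and w: "w \<in> V \<rightarrow> carrier C" and gen: "carrier C = eval \<Sigma> C w ` terms \<Sigma> V"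
    and eq: "\<And>s t. s \<in> terms \<Sigma> V \<Longrightarrow> t \<in> terms \<Sigma> V \<Longrightarrow>
      eval \<Sigma> C w s = eval \<Sigma> C w t \<longleftrightarrow> (\<forall>(D, v) \<in> {(A, v)}. eval \<Sigma> D v s = eval \<Sigma> D v t)"
    using term_quotient[OF g, of "{(A, v)}"] by blast
  obtain h where h: "h \<in> hom \<Sigma> C A" "\<And>t. t \<in> terms \<Sigma> V \<Longrightarrow> h (eval \<Sigma> C w t) = eval \<Sigma> A v t"
    using generated_hom[OF C(1) w gen A v] eq by auto
  have "inj_on h (carrier C)"
    using h(2) eq by (auto simp: gen inj_on_def)
  moreover have "v x \<in> h ` carrier C" if "x \<in> V" for x
    using h(2)[of "Var x"] w that by (auto simp: terms.Var intro!: image_eqI[of _ h "w x"])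
  ultimately show thesis
    using that C h(1) by blast
qed

text \<open>
  A finite nonempty set is the range of a sequence, so all finitely generated subalgebras are images
  of one term algebra over \<open>nat\<close>, and up to isomorphism have carriers in one small set.
\<close>

lemma almost_embedding_finitely_generated:
  fixes A :: "('f, 'i, 'u) algebra" and g :: "('f, 'i, nat) tm \<Rightarrow> 'u"
  assumes g: "inj_on g (terms \<Sigma> UNIV)" and fin: "finitary \<Sigma>" and A: "algebra \<Sigma> A"
    and ne: "carrier A \<noteq> {}"
  obtains F C e where "ultrafilter_on {S. finite S \<and> S \<subseteq> carrier A} F"
    "almost_embedding \<Sigma> {S. finite S \<and> S \<subseteq> carrier A} F A C e"
    "\<And>S. finite S \<Longrightarrow> S \<subseteq> carrier A \<Longrightarrow> algebra \<Sigma> (C S) \<and>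
      carrier (C S) \<subseteq> g ` terms \<Sigma> UNIV \<and> embeddable \<Sigma> (C S) A"
proof -
  let ?I = "{S. finite S \<and> S \<subseteq> carrier A}"
  obtain a\<^sub>0 where a\<^sub>0: "a\<^sub>0 \<in> carrier A"
    using ne by blast
  obtain F where F: "ultrafilter_on ?I F" and mem: "\<And>a. a \<in> carrier A \<Longrightarrow> \<forall>\<^sub>F S in F. a \<in> S"
    using ultrafilter_on_finite_subsets[of "carrier A"] by blast
  have "\<forall>S\<in>?I. \<exists>C h. algebra \<Sigma> C \<and> carrier C \<subseteq> g ` terms \<Sigma> UNIV \<and> h \<in> hom \<Sigma> C A \<and>
      inj_on h (carrier C) \<and> insert a\<^sub>0 S \<subseteq> h ` carrier C"
  proof
    fix S assume "S \<in> ?I"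
    \<comment> \<open>Adding \<open>a\<^sub>0\<close> makes the set nonempty also for
      \<open>S = {}\<close>, so it is the range of a sequence.\<close>
    then have "range (from_nat_into (insert a\<^sub>0 S)) = insert a\<^sub>0 S" "insert a\<^sub>0 S \<subseteq> carrier A"
      using a\<^sub>0 by (auto intro!: range_from_nat_into countable_finite)
    then have "from_nat_into (insert a\<^sub>0 S) \<in> UNIV \<rightarrow> carrier A"
      using from_nat_into[of "insert a\<^sub>0 S"] by blast
    from generated_copy[OF g A this]
    show "\<exists>C h. algebra \<Sigma> C \<and> carrier C \<subseteq> g ` terms \<Sigma> UNIV \<and> h \<in> hom \<Sigma> C A \<and>
        inj_on h (carrier C) \<and> insert a\<^sub>0 S \<subseteq> h ` carrier C"
      using \<open>range (from_nat_into (insert a\<^sub>0 S)) = insert a\<^sub>0 S\<close> by metis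
  qed
  then obtain C h where Ch: "\<forall>S\<in>?I. algebra \<Sigma> (C S) \<and> carrier (C S) \<subseteq> g ` terms \<Sigma> UNIV \<and>
      h S \<in> hom \<Sigma> (C S) A \<and> inj_on (h S) (carrier (C S)) \<and> insert a\<^sub>0 S \<subseteq> h S ` carrier (C S)"
    unfolding bchoice_iff by (elim exE)
  then have C: "\<And>S. S \<in> ?I \<Longrightarrow> algebra \<Sigma> (C S)"
      "\<And>S. S \<in> ?I \<Longrightarrow> carrier (C S) \<subseteq> g ` terms \<Sigma> UNIV"
    and h: "\<And>S. S \<in> ?I \<Longrightarrow> h S \<in> hom \<Sigma> (C S) A" "\<And>S. S \<in> ?I \<Longrightarrow> inj_on (h S) (carrier (C S))"
    and gen: "\<And>S. S \<in> ?I \<Longrightarrow> insert a\<^sub>0 S \<subseteq> h S ` carrier (C S)"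
    by simp_all
  \<comment> \<open>The preimage of \<open>a\<close> under \<open>h S\<close>. Elements outside the
    image are replaced by \<open>a\<^sub>0\<close>, which every image contains; for each
    \<open>a\<close> this happens only at sets \<open>S\<close> that omit \<open>a\<close>.\<close>
  define e where "e a S = inv_into (carrier (C S)) (h S) (if a \<in> h S ` carrier (C S) then a else a\<^sub>0)"
    for a S
  have e: "e a S \<in> carrier (C S)" if "S \<in> ?I" for a S
    using gen[OF that] by (auto simp: e_def intro: inv_into_into)
  have e_inv: "e (h S c) S = c" if "S \<in> ?I" "c \<in> carrier (C S)" for S c
    using h(2)[OF that(1)] that(2) by (simp add: e_def)
  have h_e: "h S (e a S) = a" if "S \<in> ?I" "a \<in> S" for S a
    using gen[OF that(1)] that(2) by (auto simp: e_def f_inv_into_f)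
  have "almost_embedding \<Sigma> ?I F A C e"
    unfolding almost_embedding_def
  proof (intro conjI ballI impI)
    fix f x assume f: "f \<in> symbols \<Sigma>" and x: "x \<in> arity \<Sigma> f \<rightarrow>\<^sub>E carrier A"
    have "\<forall>\<^sub>F S in F. \<forall>k\<in>arity \<Sigma> f. x k \<in> S"
      using fin f mem PiE_mem[OF x] by (simp add: finitary_def eventually_ball_finite)
    then show "\<forall>\<^sub>F S in F. e (oper A f x) S = oper (C S) f (\<lambda>k \<in> arity \<Sigma> f. e (x k) S)"
      using ultrafilter_on_in[OF F]
    proof eventually_elim
      case (elim S)
      \<comment> \<open>\<open>S\<close> contains all arguments, so \<open>h S\<close> maps
        \<open>?y\<close> back to \<open>x\<close>. Hence \<open>oper A f x\<close> is in the image
        of \<open>h S\<close>, and \<open>e\<close> inverts \<open>h S\<close> there.\<close>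
      let ?y = "\<lambda>k \<in> arity \<Sigma> f. e (x k) S"
      have y: "?y \<in> arity \<Sigma> f \<rightarrow>\<^sub>E carrier (C S)"
        using e[OF elim(2)] by simp
      have "(\<lambda>k \<in> arity \<Sigma> f. h S (?y k)) = x"
        using x h_e[OF elim(2)] elim(1)
        by (intro PiE_ext[of _ "arity \<Sigma> f" "\<lambda>_. carrier A"]) (auto dest: PiE_mem)
      then have "h S (oper (C S) f ?y) = oper A f x"
        using hom_oper[OF h(1)[OF elim(2)] f y] by simp
      then show ?case
        using e_inv[OF elim(2) algebra_closed[OF C(1)[OF elim(2)] f y]] by simp
    qed
  next
    fix a b assume "a \<in> carrier A" "b \<in> carrier A" and eq: "\<forall>\<^sub>F S in F. e a S = e b S"
    then have "\<forall>\<^sub>F S in F. a \<in> S" "\<forall>\<^sub>F S in F. b \<in> S"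
      using mem by auto
    then have "\<forall>\<^sub>F S in F. a = b"
      using eq ultrafilter_on_in[OF F] by eventually_elim (metis h_e)
    then show "a = b"
      using F by (simp add: ultrafilter_on_def)
  qed (rule e)
  moreover have "algebra \<Sigma> (C S) \<and> carrier (C S) \<subseteq> g ` terms \<Sigma> UNIV \<and> embeddable \<Sigma> (C S) A"
    if "finite S" "S \<subseteq> carrier A" for S
  proof -
    have "S \<in> ?I"
      using that by simp
    from C[OF this] h[OF this] show ?thesis
      unfolding embeddable_def by blast
  qed
  ultimately show thesis
    by (rule that[OF F])
qed

context inaccessible_universe
begin

lemma small_algebras_on:
  fixes \<Sigma> :: "('f, 'i) signature" and M :: "'u set"
  assumes \<Sigma>: "small_signature TYPE('u) \<Sigma>" and M: "small TYPE('u) M"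
  shows "small TYPE('u) {A :: ('f, 'i, 'u) algebra. algebra \<Sigma> A \<and> carrier A \<subseteq> M}"
proof (rule small_inj_on)
  let ?O = "\<lambda>C :: 'u set. \<Pi>\<^sub>E f \<in> symbols \<Sigma>. (arity \<Sigma> f \<rightarrow>\<^sub>E C) \<rightarrow>\<^sub>E C"
  show "inj_on (\<lambda>A. (carrier A, oper A)) {A. algebra \<Sigma> A \<and> carrier A \<subseteq> M}"
    by (rule inj_onI) (simp add: algebra.equality)
  show "(\<lambda>A. (carrier A, oper A)) ` {A. algebra \<Sigma> A \<and> carrier A \<subseteq> M} \<subseteq> Sigma (Pow M) ?O"
    by (auto simp: algebra_def)
  have "small TYPE('u) C" if "C \<in> Pow M" for C
    using small_subset[OF M] that by blast
  then show "small TYPE('u) (Sigma (Pow M) ?O)"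
    using \<Sigma> M unfolding small_signature_def by (intro small_Sigma small_Pow small_PiE) auto
qed

lemma all_imp_single_generator:
  fixes P :: "('f, 'i, 'u) algebra set"
  assumes \<Sigma>: "small_signature TYPE('u) \<Sigma>" and P: "quasivariety \<Sigma> P"
    and all: "\<And>X. X \<subseteq> P \<Longrightarrow> small TYPE('u) X \<Longrightarrow> (\<And>A. A \<in> X \<Longrightarrow> \<not> trivial A) \<Longrightarrow>
      jointly_embeddable \<Sigma> P X"
  shows "\<exists>D\<in>P. P = quasivariety_generated \<Sigma> {D}"
proof -
  have fin: "finitary \<Sigma>" and pre: "prevariety \<Sigma> P"
    using P by (auto simp: quasivariety_def)
  note PA = prevariety_algebras[OF pre]
  have T: "small TYPE('u) (terms \<Sigma> (UNIV :: nat set))"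
    by (rule small_terms[OF \<Sigma> small_nat])
  then obtain g :: "('f, 'i, nat) tm \<Rightarrow> 'u" where g: "inj_on g (terms \<Sigma> UNIV)"
    using small_code by blast
  define M where "M = g ` terms \<Sigma> UNIV"
  have M: "small TYPE('u) M"
    unfolding M_def by (rule small_image[OF T])
  \<comment> \<open>Since \<open>M\<close> codes all terms in countably many variables,
    \<open>X\<close> contains a copy of every nontrivial finitely generated member of
    \<open>P\<close>, and it is small by \<open>small_algebras_on\<close>.\<close>
  define X where "X = {A \<in> P. carrier A \<subseteq> M \<and> \<not> trivial A}"
  have "small TYPE('u) X"
    using small_algebras_on[OF \<Sigma> M] by (rule small_subset) (use PA in \<open>auto simp: X_def algebras_def\<close>)
  then have "jointly_embeddable \<Sigma> P X"
    by (intro all) (auto simp: X_def)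
  then obtain D where D: "D \<in> P" "\<And>A. A \<in> X \<Longrightarrow> embeddable \<Sigma> A D"
    by (auto simp: jointly_embeddable_def)
  have "P \<subseteq> Q" if Q: "quasivariety \<Sigma> Q" and "D \<in> Q" for Q
  proof
    fix A assume A: "A \<in> P"
    have preQ: "prevariety \<Sigma> Q" and ultraQ: "Ultraprod \<Sigma> Q \<subseteq> Q"
      using Q by (auto simp: quasivariety_def)
    have A_alg: "A \<in> algebras \<Sigma>"
      using A PA by blast
    have alg: "algebra \<Sigma> A" and small_A: "small TYPE('u) (carrier A)"
      using A_alg by (simp_all add: algebras_def)
    show "A \<in> Q"
    proof (cases "carrier A = {}")
      case True
      then show ?thesis
        using prevariety_embeddable[OF preQ A_alg \<open>D \<in> Q\<close>] embeddable_empty[OF alg] by blast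
    next
      case False
      let ?I = "{S. finite S \<and> S \<subseteq> carrier A}"
      obtain F C e where F: "ultrafilter_on ?I F" and e: "almost_embedding \<Sigma> ?I F A C e"
        and C: "\<And>S. finite S \<Longrightarrow> S \<subseteq> carrier A \<Longrightarrow> algebra \<Sigma> (C S) \<and>
          carrier (C S) \<subseteq> g ` terms \<Sigma> UNIV \<and> embeddable \<Sigma> (C S) A"
        using almost_embedding_finitely_generated[OF g fin alg False] by blast
      have CQ: "C S \<in> Q" if "S \<in> ?I" for S
      proof -
        have CS: "algebra \<Sigma> (C S)" "carrier (C S) \<subseteq> M" "embeddable \<Sigma> (C S) A"
          using that C by (auto simp: M_def)
        then have CS_alg: "C S \<in> algebras \<Sigma>"
          using small_subset[OF M] by (simp add: algebras_def)
        show ?thesis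
        proof (cases "trivial (C S)")
          \<comment> \<open>Trivial algebras were left out of \<open>X\<close> and need not embed in
            \<open>D\<close>, but every prevariety contains them.\<close>
          case True
          then show ?thesis
            by (rule prevariety_trivial[OF preQ CS_alg])
        next
          case False
          then have "C S \<in> X"
            using CS prevariety_embeddable[OF pre CS_alg A] by (simp add: X_def)
          then show ?thesis
            using prevariety_embeddable[OF preQ CS_alg \<open>D \<in> Q\<close>] D(2) by blast
        qed
      qed
      have I: "small TYPE('u) ?I"
        using small_Pow[OF small_A] by (rule small_subset) auto
      obtain E where E: "E \<in> Ultraprod \<Sigma> Q" and emb: "\<And>(A :: ('f, 'i, 'u) algebra) e.
          algebra \<Sigma> A \<Longrightarrow> almost_embedding \<Sigma> ?I F A C e \<Longrightarrow> embeddable \<Sigma> A E"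
        using Ultraprod_embeds[where B = C, OF fin I F CQ prevariety_algebras[OF preQ]] by blast
      show ?thesis
        using prevariety_embeddable[OF preQ A_alg _ emb[OF alg e]] E ultraQ by blast
    qed
  qed
  then have "P \<subseteq> quasivariety_generated \<Sigma> {D}"
    unfolding quasivariety_generated_def by blast
  moreover have "quasivariety_generated \<Sigma> {D} \<subseteq> P"
    using quasivariety_generated_least[OF P] D(1) by blast
  ultimately show ?thesis
    using D(1) by blast
qed

lemma directed_generator_imp_all:
  fixes P :: "('f, 'i, 'u) algebra set"
  assumes P: "prevariety \<Sigma> P" and K: "K \<subseteq> P" "absolutely_directed TYPE('u) (embeddable \<Sigma>) K"
    and gen: "P = prevariety_generated \<Sigma> K"
    and X: "X \<subseteq> P" "small TYPE('u) X" and nt: "\<And>A. A \<in> X \<Longrightarrow> \<not> trivial A"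
  shows "jointly_embeddable \<Sigma> P X"
proof -
  note PA = prevariety_algebras[OF P]
  have KA: "K \<subseteq> algebras \<Sigma>"
    using K(1) PA by blast
  have "\<forall>A\<in>X. \<exists>(I :: 'u set) B h. small TYPE('u) I \<and> (\<forall>i\<in>I. B i \<in> K) \<and> separating \<Sigma> I A B h"
  proof
    fix A assume "A \<in> X"
    then have "A \<in> prevariety_generated \<Sigma> K"
      using X(1) gen by blast
    then show "\<exists>(I :: 'u set) B h. small TYPE('u) I \<and> (\<forall>i\<in>I. B i \<in> K) \<and> separating \<Sigma> I A B h"
      using prevariety_generated_separating[OF _ KA] by metis
  qed
  then obtain I :: "_ \<Rightarrow> 'u set" and B h where I: "\<And>A. A \<in> X \<Longrightarrow> small TYPE('u) (I A)"
    and B: "\<And>A i. A \<in> X \<Longrightarrow> i \<in> I A \<Longrightarrow> B A i \<in> K"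
    and sep: "\<And>A. A \<in> X \<Longrightarrow> separating \<Sigma> (I A) A (B A) (h A)"
    by metis
  let ?Y = "\<Union>A\<in>X. B A ` I A"
  have "?Y \<subseteq> K \<and> small TYPE('u) ?Y"
    using B I by (auto intro!: small_UN small_image X(2))
  then obtain C where C: "C \<in> K" "\<forall>D\<in>?Y. embeddable \<Sigma> D C"
    using K(2)[unfolded absolutely_directed_def, rule_format, of ?Y] by blast
  then have "\<forall>A\<in>X. \<forall>i\<in>I A. \<exists>k. k \<in> hom \<Sigma> (B A i) C \<and> inj_on k (carrier (B A i))"
    unfolding embeddable_def by blast
  then obtain k where k: "\<And>A i. A \<in> X \<Longrightarrow> i \<in> I A \<Longrightarrow> k A i \<in> hom \<Sigma> (B A i) C"
    "\<And>A i. A \<in> X \<Longrightarrow> i \<in> I A \<Longrightarrow> inj_on (k A i) (carrier (B A i))"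
    by metis
  \<comment> \<open>One exponent for all \<open>A\<close> in \<open>X\<close>. The index sets may
    overlap without harm, because every factor of the power is \<open>C\<close>.\<close>
  define J where "J = (\<Union>A\<in>X. I A)"
  have J: "small TYPE('u) J"
    unfolding J_def using I by (intro small_UN X(2))
  have "C \<in> P"
    using C(1) K(1) by blast
  then obtain E where E: "E \<in> Prod \<Sigma> P" and emb: "\<And>(A :: ('f, 'i, 'u) algebra) h.
      algebra \<Sigma> A \<Longrightarrow> separating \<Sigma> J A (\<lambda>_. C) h \<Longrightarrow> embeddable \<Sigma> A E"
    using Prod_embeds[where B = "\<lambda>_. C", OF J _ PA] by blast
  have "embeddable \<Sigma> A E" if A: "A \<in> X" for A
  proof (cases "carrier A = {}")
    case True
    then show ?thesis
      using embeddable_empty subset_algebrasD(1)[OF PA] A X(1) by blast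
  next
    case False
    have alg: "algebra \<Sigma> A"
      using A X(1) subset_algebrasD(1)[OF PA] by blast
    have h: "h A i \<in> hom \<Sigma> A (B A i)" if "i \<in> I A" for i
      using sep[OF A] that by (simp add: separating_def)
    obtain a b where "a \<in> carrier A" "b \<in> carrier A" "a \<noteq> b"
      using not_trivialE[OF nt[OF A] False] .
    then obtain i\<^sub>0 where i\<^sub>0: "i\<^sub>0 \<in> I A"
      using sep[OF A] unfolding separating_def by blast
    \<comment> \<open>Indices belonging to other algebras repeat the coordinate
      \<open>i\<^sub>0\<close>. It exists because \<open>A\<close> has two distinct elements, which
      an empty family could not separate.\<close>
    define r where "r i = (if i \<in> I A then i else i\<^sub>0)" for i
    have r: "r i \<in> I A" for i
      using i\<^sub>0 by (simp add: r_def)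
    have "separating \<Sigma> J A (\<lambda>_. C) (\<lambda>i. compose (carrier A) (k A (r i)) (h A (r i)))"
      unfolding separating_def
    proof (intro conjI ballI impI)
      show "compose (carrier A) (k A (r i)) (h A (r i)) \<in> hom \<Sigma> A C" for i
        by (rule hom_compose[OF alg h[OF r] k(1)[OF A r]])
      fix x y assume xy: "x \<in> carrier A" "y \<in> carrier A"
        and eq: "\<forall>i\<in>J. compose (carrier A) (k A (r i)) (h A (r i)) x =
          compose (carrier A) (k A (r i)) (h A (r i)) y"
      have "h A i x = h A i y" if i: "i \<in> I A" for i
      proof -
        have "i \<in> J" "r i = i"
          using i A by (auto simp: J_def r_def)
        then have "k A i (h A i x) = k A i (h A i y)"
          using eq xy by (force simp: compose_eq)
        then show ?thesis
          using inj_onD[OF k(2)[OF A i]] hom_closed[OF h[OF i]] xy by blast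
      qed
      then show "x = y"
        using sep[OF A] xy by (simp add: separating_def)
    qed
    then show ?thesis
      by (rule emb[OF alg])
  qed
  then show ?thesis
    using E P unfolding jointly_embeddable_def prevariety_def by blast
qed

lemma all_imp_directed_generator:
  fixes P :: "('f, 'i, 'u) algebra set"
  assumes P: "prevariety \<Sigma> P"
    and all: "\<And>X. X \<subseteq> P \<Longrightarrow> small TYPE('u) X \<Longrightarrow> (\<And>A. A \<in> X \<Longrightarrow> \<not> trivial A) \<Longrightarrow>
      jointly_embeddable \<Sigma> P X"
  shows "\<exists>K \<subseteq> P. absolutely_directed TYPE('u) (embeddable \<Sigma>) K \<and> P = prevariety_generated \<Sigma> K"
proof -
  note PA = prevariety_algebras[OF P]
  note alg = subset_algebrasD(1)[OF PA]
  define N where "N = {A \<in> P. \<not> trivial A}"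
  \<comment> \<open>An embedding of the empty algebra alone may have a trivial target, which is not in \<open>N\<close>.\<close>
  define K where "K = (if N = {} then P else N)"
  have K: "K \<subseteq> P"
    by (auto simp: K_def N_def)
  then have KA: "K \<subseteq> algebras \<Sigma>"
    using PA by blast
  have "\<exists>B\<in>K. \<forall>A\<in>X. embeddable \<Sigma> A B" if X: "X \<subseteq> K" "small TYPE('u) X" for X
  proof (cases "N = {}")
    \<comment> \<open>A directed class must also bound the empty set, so \<open>K\<close> cannot be
      empty. Here \<open>P\<close> consists of trivial algebras, and any one of them bounds all the
      others.\<close>
    case True
    obtain T :: "('f, 'i, 'u) algebra" where T: "T \<in> algebras \<Sigma>" "trivial T"
      using ex_trivial .
    have TP: "T \<in> P"
      by (rule prevariety_trivial[OF P T])
    have "embeddable \<Sigma> A T" if "A \<in> X" for A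
    proof -
      have A: "A \<in> P" "trivial A"
        using that X(1) True K by (auto simp: N_def)
      obtain t where t: "carrier T = {t}"
        using T(2) by (auto simp: trivial_def)
      then have "(\<lambda>a \<in> carrier A. t) \<in> hom \<Sigma> A T"
        using hom_to_trivial[OF alg[OF A(1)] alg[OF TP]] by blast
      then show ?thesis
        using A(2) unfolding embeddable_def trivial_def by (auto intro!: bexI)
    qed
    then show ?thesis
      using TP True by (auto simp: K_def)
  next
    case False
    then have XN: "X \<subseteq> N" and KN: "K = N"
      using X(1) by (auto simp: K_def)
    have "jointly_embeddable \<Sigma> P X"
      using XN X(2) by (intro all) (auto simp: N_def)
    then obtain D where D: "D \<in> P" "\<forall>A\<in>X. embeddable \<Sigma> A D"
      by (auto simp: jointly_embeddable_def)
    show ?thesis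
    proof (cases "trivial D")
      \<comment> \<open>Only empty algebras are nontrivial and embed in a trivial one, so any member
        of \<open>N\<close> is a bound.\<close>
      case True
      obtain B where B: "B \<in> N"
        using False by blast
      have "embeddable \<Sigma> A B" if "A \<in> X" for A
      proof -
        have A: "A \<in> P" "\<not> trivial A"
          using that XN by (auto simp: N_def)
        show ?thesis
          using embeddable_empty[OF alg[OF A(1)] embeddable_in_trivial[OF _ True A(2)]] D(2) that
          by blast
      qed
      then show ?thesis
        using B KN by blast
    next
      case False
      then show ?thesis
        using D KN by (auto simp: N_def)
    qed
  qed
  then have "absolutely_directed TYPE('u) (embeddable \<Sigma>) K"
    by (simp add: absolutely_directed_def)
  moreover have "P = prevariety_generated \<Sigma> K"
  proof
    have "Prod \<Sigma> K \<subseteq> Prod \<Sigma> P"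
      using K by (auto simp: Prod_def)
    then have sub: "Prod \<Sigma> K \<subseteq> P"
      using P by (auto simp: prevariety_def)
    then have sub': "Prod \<Sigma> K \<subseteq> algebras \<Sigma>"
      using PA by blast
    show "prevariety_generated \<Sigma> K \<subseteq> P"
      unfolding prevariety_generated_def Sub_iff[OF sub']
      using prevariety_embeddable[OF P] sub Sub_iff[OF sub'] by blast
    show "P \<subseteq> prevariety_generated \<Sigma> K"
    proof
      fix A assume A: "A \<in> P"
      have A_alg: "A \<in> algebras \<Sigma>"
        using A PA by blast
      \<comment> \<open>\<open>A\<close> is a power of a member of \<open>K\<close> with exponent
        zero or one: trivial algebras, possibly outside \<open>K\<close>, come from the empty
        product.\<close>
      obtain I :: "nat set" and h where I: "small TYPE('u) I" "\<And>i. i \<in> I \<Longrightarrow> A \<in> K"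
        and sep: "separating \<Sigma> I A (\<lambda>_. A) h"
      proof (cases "trivial A")
        case True
        then have "separating \<Sigma> {} A (\<lambda>_. A) (\<lambda>_::nat. id)"
          by (auto simp: separating_def trivial_def)
        then show thesis
          using that[of "{}"] by (simp add: small_finite)
      next
        case False
        then have "A \<in> K"
          using A by (auto simp: K_def N_def)
        moreover obtain h where "h \<in> hom \<Sigma> A A" "inj_on h (carrier A)"
          using embeddable_refl[OF alg[OF A]] by (auto simp: embeddable_def)
        then have "separating \<Sigma> {0} A (\<lambda>_. A) (\<lambda>_::nat. h)"
          by (auto simp: separating_def inj_on_def)
        ultimately show thesis
          using that[of "{0}"] by (simp add: small_finite)
      qed
      obtain E where "E \<in> Prod \<Sigma> K" "embeddable \<Sigma> A E"
        using Prod_embeds[where B = "\<lambda>_. A", OF I KA] sep alg[OF A] by metis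
      then show "A \<in> prevariety_generated \<Sigma> K"
        unfolding prevariety_generated_def Sub_iff[OF sub'] using A_alg by blast
    qed
  qed
  ultimately show ?thesis
    using K by blast
qed

end

theorem theorem23:
  fixes \<Sigma> :: "('f, 'i) signature"
    and P :: "('f, 'i, 'u) algebra set"
  assumes "inaccessible TYPE('u)"
    and "small_signature TYPE('u) \<Sigma>"
    and "prevariety \<Sigma> P"
  shows
    "((\<forall>X. X \<subseteq> P \<and> small TYPE('u) X \<and> (\<forall>A\<in>X. \<not> trivial A) \<longrightarrow> compatible \<Sigma> P X)
        \<longleftrightarrow> (\<exists>K \<subseteq> P. absolutely_directed TYPE('u) (embeddable \<Sigma>) K \<and>
               P = prevariety_generated \<Sigma> K)) \<and>
     (quasivariety \<Sigma> P \<longrightarrow>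
       ((\<forall>X. X \<subseteq> P \<and> small TYPE('u) X \<and> (\<forall>A\<in>X. \<not> trivial A) \<longrightarrow> compatible \<Sigma> P X)
          \<longleftrightarrow> (\<forall>A\<in>P. \<forall>B\<in>P. \<not> trivial A \<and> \<not> trivial B \<longrightarrow> compatible \<Sigma> P {A, B})) \<and>
       ((\<forall>X. X \<subseteq> P \<and> small TYPE('u) X \<and> (\<forall>A\<in>X. \<not> trivial A) \<longrightarrow> compatible \<Sigma> P X)
          \<longleftrightarrow> (\<exists>K \<subseteq> P. absolutely_directed TYPE('u) (embeddable \<Sigma>) K \<and>
                 P = quasivariety_generated \<Sigma> K)) \<and>
       ((\<forall>X. X \<subseteq> P \<and> small TYPE('u) X \<and> (\<forall>A\<in>X. \<not> trivial A) \<longrightarrow> compatible \<Sigma> P X)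
          \<longleftrightarrow> (\<exists>A\<in>P. P = quasivariety_generated \<Sigma> {A})))"
    (is "(?all \<longleftrightarrow> ?prevariety) \<and> (_ \<longrightarrow> (_ \<longleftrightarrow> ?pairs) \<and> (_ \<longleftrightarrow> ?quasivariety) \<and> (_ \<longleftrightarrow> ?single))")
proof -
  note P = assms(3)
  interpret inaccessible_universe "TYPE('u)"
    using assms(1) by unfold_locales
  have compatible: "compatible \<Sigma> P X \<longleftrightarrow> jointly_embeddable \<Sigma> P X"
    if "X \<subseteq> P" "small TYPE('u) X" for X
    using compatible_iff[OF assms(2) P that] by (simp add: jointly_embeddable_def)
  have all: "?all \<longleftrightarrow> (\<forall>X. X \<subseteq> P \<longrightarrow> small TYPE('u) X \<longrightarrow> (\<forall>A\<in>X. \<not> trivial A) \<longrightarrow> jointly_embeddable \<Sigma> P X)"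
    using compatible by metis
  have pairs: "?pairs \<longleftrightarrow>
      (\<forall>A\<in>P. \<forall>B\<in>P. \<not> trivial A \<and> \<not> trivial B \<longrightarrow> jointly_embeddable \<Sigma> P {A, B})"
    by (intro ball_cong refl imp_cong compatible) (simp_all add: small_finite)
  have "?all \<Longrightarrow> ?prevariety"
    unfolding all by (intro all_imp_directed_generator[OF P]) blast
  moreover have "?prevariety \<Longrightarrow> ?all"
    unfolding all using directed_generator_imp_all[OF P] by blast
  moreover have "(?all \<longleftrightarrow> ?pairs) \<and> (?all \<longleftrightarrow> ?quasivariety) \<and> (?all \<longleftrightarrow> ?single)"
    if Q: "quasivariety \<Sigma> P"
  proof -
    have "?all \<Longrightarrow> ?single"
      unfolding all by (intro all_imp_single_generator[OF assms(2) Q]) blast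
    moreover have "?single \<Longrightarrow> ?quasivariety"
    proof -
      assume ?single
      then obtain A where A: "A \<in> P" "P = quasivariety_generated \<Sigma> {A}"
        by blast
      \<comment> \<open>Every subset of a one-element class, the empty one included, is bounded by
        \<open>A\<close> through reflexivity.\<close>
      have "absolutely_directed TYPE('u) (embeddable \<Sigma>) {A}"
        using embeddable_refl[OF subset_algebrasD(1)[OF prevariety_algebras[OF P] A(1)]]
        by (auto simp: absolutely_directed_def)
      then show ?quasivariety
        using A by blast
    qed
    moreover have "?quasivariety \<Longrightarrow> ?pairs"
      unfolding pairs using generated_by_directed_imp_pairs[OF Q] by blast
    moreover have "?pairs \<Longrightarrow> ?all"
      unfolding all pairs using pairs_imp_all[OF Q] by blast
    ultimately show ?thesis
      by blast
  qed
  ultimately show ?thesis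
    by blast
qed

end
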